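(* Let $-A$ be the generator of a positive $C_0$-semigroup $(T(t))_{t\ge0}$ on a Banach lattice $X$ such that $\mathbb{C}_-\subseteq\rho(A)$. Let $\omega,M_\omega\ge1$ be such that $\|T(t)\|_{\mathcal{L}(X)}\le M_\omega e^{t(\omega-1)}$ for all $t\ge0$, and set $M:=\sup\{\|T(t)\|_{\mathcal{L}(X)}:t\in[0,2]\}$. Assume that one of the following conditions holds: (1) $X=L^p(\Omega)$ for $p\in[1,\infty]$ and $\Omega$ a measure space; (2) $X$ is a closed subspace of $C_b(\Omega)$, for $\Omega$ a topological space, such that either $\mathbf{1}_\Omega\in X$ or $X$ is a sublattice of $C_b(\Omega)$. Suppose that there exists a nondecreasing $g:(0,\infty)\to(0,\infty)$ such that $$\|(a+A)^{-1}\|_{\mathcal{L}(X)}\le g(1/a)\qquad(a\in(0,\infty)).$$ Then $\|T(t)\|_{\mathcal{L}(X)}\le C(g(t)+1)$ for all $t>0$, where $C=eM_\omega(1+2M\omega)$ if (1) holds, and $C=eM_\omega(1+\omega)$ if (2) holds.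
   Context: Banach spaces are nonzero and over $\mathbb{C}$; $\mathcal{L}(X)$ is the space of bounded operators on $X$. $\mathbb{C}_-=\{\mathrm{Re}(\lambda)<0\}$; $\rho(A)$ is the resolvent set of $A$. Complex Banach lattices are complexifications of real ones. $C_b(\Omega)$ is the space of bounded continuous complex-valued functions with supremum norm and pointwise order; in (2) the norm and order of the Banach lattice $X$ are inherited from $C_b(\Omega)$, and $X=X_{\mathbb{R}}+iX_{\mathbb{R}}$ with $X_{\mathbb{R}}$ the set of real-valued functions in $X$. $X$ is a sublattice of $C_b(\Omega)$ if $x\vee y,x\wedge y\in X$ (pointwise maximum and minimum) for all real-valued $x,y\in X$. An operator is positive if it maps nonnegative elements to nonnegative elements; a semigroup is positive if every $T(t)$ is positive. *)

theory Defs
  imports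
    "HOL-Analysis.Analysis"
    "HOL-Probability.Essential_Supremum"
    "HOL-Library.Nonpos_Ints"
begin

section \<open>Complex Banach spaces and their operators\<close>

class complex_banach = banach +
  fixes scaleC :: "complex \<Rightarrow> 'a \<Rightarrow> 'a"  (infixr \<open>*\<^sub>C\<close> 75)
  assumes scaleC_add_right: "c *\<^sub>C (x + y) = c *\<^sub>C x + c *\<^sub>C y"
    and scaleC_add_left: "(c + d) *\<^sub>C x = c *\<^sub>C x + d *\<^sub>C x"
    and scaleC_scaleC: "c *\<^sub>C d *\<^sub>C x = (c * d) *\<^sub>C x"
    and scaleC_of_real: "complex_of_real r *\<^sub>C x = r *\<^sub>R x"
    and norm_scaleC: "norm (c *\<^sub>C x) = cmod c * norm x"

instantiation complex :: complex_banach
begin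

definition scaleC_complex :: "complex \<Rightarrow> complex \<Rightarrow> complex"
  where "scaleC_complex c x = c * x"

instance
  by standard (simp_all add: scaleC_complex_def algebra_simps norm_mult scaleR_conv_of_real)

end

definition bounded_clinear :: "('a::complex_banach \<Rightarrow> 'a) \<Rightarrow> bool"
  where "bounded_clinear T \<longleftrightarrow>
    bounded_linear T \<and> (\<forall>c x. T (c *\<^sub>C x) = c *\<^sub>C T x)"

text \<open>An unbounded operator is a pair of a domain \<open>D\<close> and a function \<open>A\<close>, whose values outside
  \<open>D\<close> are irrelevant.\<close>

definition resolvent_set :: "'a::complex_banach set \<Rightarrow> ('a \<Rightarrow> 'a) \<Rightarrow> complex set"
  where "resolvent_set D A =
    {l. bij_betw (\<lambda>x. l *\<^sub>C x - A x) D UNIV \<and>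
        bounded_clinear (inv_into D (\<lambda>x. l *\<^sub>C x - A x))}"

definition C0_semigroup :: "(real \<Rightarrow> 'a::complex_banach \<Rightarrow> 'a) \<Rightarrow> bool"
  where "C0_semigroup T \<longleftrightarrow>
    (\<forall>t\<ge>0. bounded_clinear (T t)) \<and>
    T 0 = id \<and>
    (\<forall>s\<ge>0. \<forall>t\<ge>0. T (s + t) = T s \<circ> T t) \<and>
    (\<forall>x. ((\<lambda>t. T t x) \<longlongrightarrow> x) (at_right 0))"

definition generator ::
    "(real \<Rightarrow> 'a::complex_banach \<Rightarrow> 'a) \<Rightarrow> 'a set \<Rightarrow> ('a \<Rightarrow> 'a) \<Rightarrow> bool"
  where "generator T D B \<longleftrightarrow>
    D = {x. \<exists>y. ((\<lambda>h. (T h x - x) /\<^sub>R h) \<longlongrightarrow> y) (at_right 0)} \<and>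
    (\<forall>x\<in>D. ((\<lambda>h. (T h x - x) /\<^sub>R h) \<longlongrightarrow> B x) (at_right 0))"


section \<open>Complex Banach lattices\<close>

text \<open>\<open>R\<close> is the real part of the space and \<open>P\<close> its positive cone, so that the order is
  \<open>x \<le> y \<longleftrightarrow> y - x \<in> P\<close>.\<close>

definition is_lub_in :: "'a::real_vector set \<Rightarrow> 'a set \<Rightarrow> 'a set \<Rightarrow> 'a \<Rightarrow> bool"
  where "is_lub_in R P S m \<longleftrightarrow>
    m \<in> R \<and> (\<forall>s\<in>S. m - s \<in> P) \<and>
    (\<forall>u\<in>R. (\<forall>s\<in>S. u - s \<in> P) \<longrightarrow> u - m \<in> P)"

text \<open>Infima need no axiom: the infimum of \<open>x\<close> and \<open>y\<close> is minus the supremum of \<open>-x\<close> and \<open>-y\<close>.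
  The absolute value is \<open>\<bar>x\<bar> = sup x (-x)\<close> on \<open>R\<close>; on the complexification, the modulus of
  \<open>x + i y\<close> is the supremum over \<open>\<theta>\<close> of \<open>cos \<theta> x + sin \<theta> y\<close>, and the norm of an element is the
  norm of its modulus.\<close>

locale complex_banach_lattice =
  fixes R P :: "'a::complex_banach set"
  assumes subspace_R: "subspace R"
    and closed_R: "closed R"
    and decomposition:
      "\<And>z. \<exists>!(x, y). x \<in> R \<and> y \<in> R \<and> z = x + \<i> *\<^sub>C y"
    and P_subset: "P \<subseteq> R"
    and zero_in_P: "0 \<in> P"
    and P_add: "\<And>x y. x \<in> P \<Longrightarrow> y \<in> P \<Longrightarrow> x + y \<in> P"
    and P_scale: "\<And>r x. 0 \<le> r \<Longrightarrow> x \<in> P \<Longrightarrow> r *\<^sub>R x \<in> P"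
    and P_proper: "\<And>x. x \<in> P \<Longrightarrow> - x \<in> P \<Longrightarrow> x = 0"
    and lattice: "\<And>x y. x \<in> R \<Longrightarrow> y \<in> R \<Longrightarrow> \<exists>m. is_lub_in R P {x, y} m"
    and lattice_norm:
      "\<And>x y a b. x \<in> R \<Longrightarrow> y \<in> R \<Longrightarrow> is_lub_in R P {x, - x} a \<Longrightarrow>
        is_lub_in R P {y, - y} b \<Longrightarrow> b - a \<in> P \<Longrightarrow> norm x \<le> norm y"
    and complex_norm:
      "\<And>x y. x \<in> R \<Longrightarrow> y \<in> R \<Longrightarrow>
        \<exists>m. is_lub_in R P (range (\<lambda>\<theta>. cos \<theta> *\<^sub>R x + sin \<theta> *\<^sub>R y)) m \<and>
            norm (x + \<i> *\<^sub>C y) = norm m"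

definition positive_semigroup :: "'a set \<Rightarrow> (real \<Rightarrow> 'a \<Rightarrow> 'a) \<Rightarrow> bool"
  where "positive_semigroup P T \<longleftrightarrow> (\<forall>t\<ge>0. \<forall>x\<in>P. T t x \<in> P)"


section \<open>The two classes of concrete spaces\<close>

definition Lp_functions :: "ennreal \<Rightarrow> 'w measure \<Rightarrow> ('w \<Rightarrow> complex) set"
  where "Lp_functions p M =
    {f \<in> borel_measurable M.
      if p = \<infinity> then esssup M (\<lambda>w. ereal (cmod (f w))) < \<infinity>
      else integrable M (\<lambda>w. cmod (f w) powr enn2real p)}"

definition Lp_norm :: "ennreal \<Rightarrow> 'w measure \<Rightarrow> ('w \<Rightarrow> complex) \<Rightarrow> real"
  where "Lp_norm p M f =
    (if p = \<infinity> then real_of_ereal (esssup M (\<lambda>w. ereal (cmod (f w))))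
     else (\<integral>w. cmod (f w) powr enn2real p \<partial>M) powr (1 / enn2real p))"

text \<open>\<open>Lp_space p M \<Phi> R P\<close> says that the space is \<open>L\<^sup>p(M)\<close>, \<open>\<Phi> f\<close> being the class of the function
  \<open>f\<close> modulo equality almost everywhere: \<open>\<Phi>\<close> induces a bijection between these classes and the
  space which transports all the structure.\<close>

definition Lp_space ::
    "ennreal \<Rightarrow> 'w measure \<Rightarrow> (('w \<Rightarrow> complex) \<Rightarrow> 'a::complex_banach) \<Rightarrow> 'a set \<Rightarrow> 'a set \<Rightarrow> bool"
  where "Lp_space p M \<Phi> R P \<longleftrightarrow>
    1 \<le> p \<and>
    \<Phi> ` Lp_functions p M = UNIV \<and>
    (\<forall>f\<in>Lp_functions p M. \<forall>g\<in>Lp_functions p M. \<Phi> f = \<Phi> g \<longleftrightarrow> (AE w in M. f w = g w)) \<and>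
    (\<forall>f\<in>Lp_functions p M. \<forall>g\<in>Lp_functions p M. \<Phi> (\<lambda>w. f w + g w) = \<Phi> f + \<Phi> g) \<and>
    (\<forall>c. \<forall>f\<in>Lp_functions p M. \<Phi> (\<lambda>w. c * f w) = c *\<^sub>C \<Phi> f) \<and>
    (\<forall>f\<in>Lp_functions p M. norm (\<Phi> f) = Lp_norm p M f) \<and>
    R = \<Phi> ` {f \<in> Lp_functions p M. AE w in M. f w \<in> \<real>} \<and>
    P = \<Phi> ` {f \<in> Lp_functions p M. AE w in M. f w \<in> \<real>\<^sub>\<ge>\<^sub>0}"

text \<open>\<open>Cb_subspace J R P\<close> says that the space is a closed subspace of \<open>C\<^sub>b(\<Omega>)\<close>, \<open>J\<close> being the
  inclusion; \<open>\<Omega>\<close> is the type \<open>'w\<close>.\<close>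

definition Cb_subspace ::
    "('a::complex_banach \<Rightarrow> ('w::topological_space \<Rightarrow>\<^sub>C complex)) \<Rightarrow> 'a set \<Rightarrow> 'a set \<Rightarrow> bool"
  where "Cb_subspace J R P \<longleftrightarrow>
    (\<forall>x y w. apply_bcontfun (J (x + y)) w = apply_bcontfun (J x) w + apply_bcontfun (J y) w) \<and>
    (\<forall>c x w. apply_bcontfun (J (c *\<^sub>C x)) w = c * apply_bcontfun (J x) w) \<and>
    (\<forall>x. norm (J x) = norm x) \<and>
    closed (range J) \<and>
    R = {x. \<forall>w. apply_bcontfun (J x) w \<in> \<real>} \<and>
    P = {x. \<forall>w. apply_bcontfun (J x) w \<in> \<real>\<^sub>\<ge>\<^sub>0}"

definition contains_one :: "('a \<Rightarrow> ('w::topological_space \<Rightarrow>\<^sub>C complex)) \<Rightarrow> bool"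
  where "contains_one J \<longleftrightarrow> (\<exists>u. \<forall>w. apply_bcontfun (J u) w = 1)"

definition pointwise_sublattice ::
    "('a \<Rightarrow> ('w::topological_space \<Rightarrow>\<^sub>C complex)) \<Rightarrow> 'a set \<Rightarrow> bool"
  where "pointwise_sublattice J R \<longleftrightarrow>
    (\<forall>x\<in>R. \<forall>y\<in>R.
      (\<exists>z\<in>R. \<forall>w. Re (apply_bcontfun (J z) w) =
        max (Re (apply_bcontfun (J x) w)) (Re (apply_bcontfun (J y) w))) \<and>
      (\<exists>z\<in>R. \<forall>w. Re (apply_bcontfun (J z) w) =
        min (Re (apply_bcontfun (J x) w)) (Re (apply_bcontfun (J y) w))))"

end

theory Submission
  imports Defs
begin

text \<open>The norm of a positive operator is determined by its values on the cone, so it suffices to bound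
  \<open>\<parallel>T(t) x\<parallel>\<close> for \<open>x \<ge> 0\<close>. Put \<open>a = 1 / t\<close> and \<open>S(s) = exp (- a s) T(s)\<close>, so that
  \<open>\<parallel>T(t) x\<parallel> = e \<parallel>S(t) x\<parallel>\<close>, and let \<open>f(s) = exp (- \<omega> s) S(s) x\<close>. By the growth assumption
  \<open>\<parallel>f(s)\<parallel> \<le> M\<^sub>\<omega> exp (- s) \<parallel>x\<parallel>\<close>, and the convolution
  \<open>u(s) = \<integral>\<^bsub>0\<^esub>\<^bsup>s\<^esup> S(s - r) f(r) dr\<close> equals \<open>(1 - exp (- \<omega> s)) / \<omega>\<close> times \<open>S(s) x\<close>.
  Bounding \<open>S\<close> thus amounts to bounding \<open>u\<close> by \<open>f\<close>.

  Convolution with the positive kernel \<open>S\<close> is controlled by the total mass of the kernel, which is the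
  resolvent \<open>(a + A)\<^sup>-\<^sup>1\<close>. If all values of \<open>f\<close> lie below one vector \<open>F\<close>, then \<open>u(s)\<close> lies below
  \<open>(a + A)\<^sup>-\<^sup>1 F\<close>; in the spaces of continuous functions and in \<open>L\<^sup>\<infinity>\<close> there is such an \<open>F\<close> of norm at
  most \<open>M\<^sub>\<omega> \<parallel>x\<parallel>\<close> for any finitely many values of \<open>f\<close>, which is enough once time is discrete
  (lemmas \<open>Cb_dominated\<close> and \<open>Linf_dominated\<close>), and \<open>growth_if_dominated\<close> concludes. In
  \<open>L\<^sup>p\<close> with finite \<open>p\<close>, let \<open>F(w)\<close> be the \<open>L\<^sup>p\<close> norm in time of the orbit \<open>f\<close> at the point \<open>w\<close>.
  Testing \<open>u\<close> in time against weights from the dual unit ball shows that the \<open>L\<^sup>p\<close> norm in time of \<open>u\<close>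
  is at most \<open>(a + A)\<^sup>-\<^sup>1 F\<close>, pointwise almost everywhere (lemmas \<open>Lp_dominated\<close> and
  \<open>Lp_codominated\<close>). Integrating over \<open>w\<close> bounds \<open>u\<close> by \<open>g(t) f\<close> in the \<open>L\<^sup>p\<close> norm over time and
  space, and averaging over times just before \<open>t\<close> gives the bound at \<open>t\<close>
  (\<open>growth_if_p_dominated\<close>).

  Time is discretised with step \<open>h\<close>, where \<open>h\<close> tends to \<open>0\<close> at the end. The integral of \<open>S\<close> over
  an interval of length \<open>h\<close> is written as \<open>(I - S(h)) (a + A)\<^sup>-\<^sup>1\<close>, which makes the discrete
  convolution inequality \<open>convolution_dominated\<close> exact for every \<open>h\<close>.
  The positivity of the resolvent on the whole half-line \<open>a > 0\<close> is not immediate, since the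
  semigroup is only assumed to grow no faster than \<open>exp ((\<omega> - 1) t)\<close>: lemma \<open>Res_positive\<close>
  continues it from large \<open>a\<close> with the resolvent identity and the uniform bound given by \<open>g\<close>.\<close>


section \<open>Order and norm in a complex Banach lattice\<close>

context complex_banach_lattice
begin

lemma is_lub_in_abs_of_positive:
  assumes "x \<in> P"
  shows "is_lub_in R P {x, - x} x"
  using assms P_subset zero_in_P P_add[OF assms assms]
  by (auto simp: is_lub_in_def)

lemma norm_mono_positive:
  assumes "x \<in> P" and "y - x \<in> P"
  shows "norm x \<le> norm y"
proof -
  have "y \<in> P"
    using P_add[OF assms] by simp
  then show ?thesis
    using lattice_norm is_lub_in_abs_of_positive assms P_subset by blast
qed

lemma P_sum: "(\<And>i. i \<in> I \<Longrightarrow> f i \<in> P) \<Longrightarrow> sum f I \<in> P"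
  by (induction I rule: infinite_finite_induct) (auto simp: zero_in_P P_add)

text \<open>The negative part \<open>d\<close> of a limit \<open>x\<close> of positive elements vanishes, because the norm of \<open>d\<close> is at
  most the distance from \<open>x\<close> to any \<open>y \<in> P\<close>: both \<open>- x\<close> and \<open>0\<close> lie below \<open>\<bar>x - y\<bar>\<close>, hence so does
  their supremum \<open>d\<close>.\<close>

lemma closed_P: "closed P"
proof (rule closed_sequential_limits[THEN iffD2], intro allI impI, elim conjE)
  fix y :: "nat \<Rightarrow> 'a" and x
  assume y: "\<forall>n. y n \<in> P" and lim: "y \<longlonglongrightarrow> x"
  have x: "x \<in> R"
    using closed_sequentially[OF closed_R _ lim] y P_subset by blast
  then have mx: "- x \<in> R"
    using subspace_R by (simp add: subspace_neg)
  have zero: "0 \<in> R"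
    using zero_in_P P_subset by blast
  obtain d where d: "is_lub_in R P {- x, 0} d"
    using lattice[OF mx zero] by blast
  then have dP: "d \<in> P" and dx: "d + x \<in> P"
    unfolding is_lub_in_def by auto
  have bound: "norm d \<le> norm (x - y n)" for n
  proof -
    have yn: "y n \<in> P" "y n \<in> R"
      using y P_subset by auto
    have diff: "x - y n \<in> R" "y n - x \<in> R"
      using x yn subspace_R by (auto simp: subspace_diff)
    obtain b where b: "is_lub_in R P {x - y n, - (x - y n)} b"
      using lattice[OF diff(1), of "- (x - y n)"] diff(2) by auto
    then have bR: "b \<in> R" and b1: "b - (x - y n) \<in> P" and b2: "b + (x - y n) \<in> P"
      unfolding is_lub_in_def by (auto simp: algebra_simps)
    have "(1/2) *\<^sub>R ((b - (x - y n)) + (b + (x - y n))) \<in> P"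
      by (rule P_scale[OF _ P_add[OF b1 b2]]) simp
    then have "b - 0 \<in> P"
      by (simp add: scaleR_2[symmetric])
    moreover have "b - (- x) \<in> P"
      using P_add[OF b2 yn(1)] by simp
    ultimately have "b - d \<in> P"
      using d bR unfolding is_lub_in_def by auto
    then show ?thesis
      using lattice_norm[OF _ diff(1) is_lub_in_abs_of_positive[OF dP] b] dP P_subset by auto
  qed
  have "(\<lambda>n. norm (x - y n)) \<longlonglongrightarrow> norm (x - x)"
    by (intro tendsto_intros lim)
  then have "norm d \<le> norm (x - x)"
    by (rule LIMSEQ_le_const) (use bound in auto)
  then show "x \<in> P"
    using dx by simp
qed

lemma positive_maps_real:
  assumes B: "bounded_linear B" and pos: "\<And>x. x \<in> P \<Longrightarrow> B x \<in> P" and x: "x \<in> R"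
  shows "B x \<in> R"
proof -
  obtain m where "is_lub_in R P {x, 0} m"
    using lattice[OF x, of 0] zero_in_P P_subset by blast
  then have "m \<in> P" "m - x \<in> P"
    unfolding is_lub_in_def by auto
  then have "B m - B (m - x) \<in> R"
    using pos P_subset subspace_R by (auto intro!: subspace_diff)
  then show ?thesis
    by (simp add: linear_diff[OF bounded_linear.linear[OF B]])
qed

text \<open>The modulus \<open>m\<close> of \<open>z\<close> has the same norm as \<open>z\<close>, and \<open>B m\<close> dominates the modulus of \<open>B z\<close>: the
  elements \<open>cos \<theta> x + sin \<theta> y\<close> lie below \<open>m\<close>, so their images lie below \<open>B m\<close>. Thus the norm
  of a positive operator is determined by its values on the cone.\<close>

lemma positive_operator_norm_bound:
  assumes B: "bounded_clinear B" and pos: "\<And>x. x \<in> P \<Longrightarrow> B x \<in> P"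
    and bound: "\<And>x. x \<in> P \<Longrightarrow> norm (B x) \<le> C * norm x"
  shows "norm (B z) \<le> C * norm z"
proof -
  have lin: "bounded_linear B"
    using B by (simp add: bounded_clinear_def)
  note Badd = linear_add[OF bounded_linear.linear[OF lin]]
    and Bdiff = linear_diff[OF bounded_linear.linear[OF lin]]
    and Bscale = linear_scale[OF bounded_linear.linear[OF lin]]
  obtain x y where xy: "x \<in> R" "y \<in> R" and z: "z = x + \<i> *\<^sub>C y"
    using decomposition[of z] by auto
  have Bz: "B z = B x + \<i> *\<^sub>C B y"
    using B by (simp add: z Badd bounded_clinear_def)
  have BR: "B x \<in> R" "B y \<in> R"
    using positive_maps_real[OF lin pos] xy by auto
  obtain m where m: "is_lub_in R P (range (\<lambda>\<theta>. cos \<theta> *\<^sub>R x + sin \<theta> *\<^sub>R y)) m"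
    and norm_m: "norm z = norm m"
    using complex_norm[OF xy] z by auto
  obtain k where k: "is_lub_in R P (range (\<lambda>\<theta>. cos \<theta> *\<^sub>R B x + sin \<theta> *\<^sub>R B y)) k"
    and norm_k: "norm (B z) = norm k"
    using complex_norm[OF BR] Bz by auto
  have lub: "m - (cos \<theta> *\<^sub>R x + sin \<theta> *\<^sub>R y) \<in> P" "k - (cos \<theta> *\<^sub>R B x + sin \<theta> *\<^sub>R B y) \<in> P" for \<theta>
    using m k unfolding is_lub_in_def by auto
  \<comment> \<open>The angles \<open>0\<close> and \<open>\<pi>\<close> show that both moduli are positive.\<close>
  have "(1/2) *\<^sub>R ((m - x) + (m + x)) \<in> P" "(1/2) *\<^sub>R ((k - B x) + (k + B x)) \<in> P"
    using P_scale[OF _ P_add[OF lub(1)[of 0] lub(1)[of pi]], of "1/2"]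
      P_scale[OF _ P_add[OF lub(2)[of 0] lub(2)[of pi]], of "1/2"] by simp_all
  then have mP: "m \<in> P" and kP: "k \<in> P"
    by (simp_all add: scaleR_2[symmetric])
  have "B m \<in> R"
    using pos[OF mP] P_subset by blast
  moreover have "B m - (cos \<theta> *\<^sub>R B x + sin \<theta> *\<^sub>R B y) \<in> P" for \<theta>
    using pos[OF lub(1)[of \<theta>]] by (simp add: Badd Bdiff Bscale)
  ultimately have "B m - k \<in> P"
    using k unfolding is_lub_in_def by auto
  then have "norm k \<le> norm (B m)"
    by (rule norm_mono_positive[OF kP])
  also have "\<dots> \<le> C * norm m"
    by (rule bound[OF mP])
  finally show ?thesis
    by (simp add: norm_k norm_m)
qed

end


section \<open>The resolvent of a positive semigroup\<close>

locale positive_C0_semigroup = complex_banach_lattice R P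
  for R P :: "'a::complex_banach set" +
  fixes T :: "real \<Rightarrow> 'a \<Rightarrow> 'a" and D :: "'a set" and A :: "'a \<Rightarrow> 'a"
    and \<omega> M\<^sub>\<omega> :: real and g :: "real \<Rightarrow> real"
  assumes semigroup: "C0_semigroup T"
    and positive: "positive_semigroup P T"
    and generator: "generator T D (\<lambda>x. - A x)"
    and resolvent: "{l. Re l < 0} \<subseteq> resolvent_set D A"
    and \<omega>: "\<omega> \<ge> 1" and M\<omega>: "M\<^sub>\<omega> \<ge> 1"
    and growth: "\<And>t. t \<ge> 0 \<Longrightarrow> onorm (T t) \<le> M\<^sub>\<omega> * exp (t * (\<omega> - 1))"
    and g_pos: "\<And>s. s > 0 \<Longrightarrow> g s > 0"
    and g_mono: "mono_on {0<..} g"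
    and g_bound: "\<And>a. a > 0 \<Longrightarrow>
      onorm (inv_into D (\<lambda>x. complex_of_real a *\<^sub>C x + A x)) \<le> g (1 / a)"
begin

definition Res :: "real \<Rightarrow> 'a \<Rightarrow> 'a"
  where "Res a = inv_into D (\<lambda>x. complex_of_real a *\<^sub>C x + A x)"

text \<open>\<open>S a\<close> is the semigroup generated by \<open>- (a + A)\<close>.\<close>

definition S :: "real \<Rightarrow> real \<Rightarrow> 'a \<Rightarrow> 'a"
  where "S a t x = exp (- (a * t)) *\<^sub>R T t x"

lemma T_bounded_clinear: "t \<ge> 0 \<Longrightarrow> bounded_clinear (T t)"
  using semigroup by (simp add: C0_semigroup_def)

lemma T_bounded_linear: "t \<ge> 0 \<Longrightarrow> bounded_linear (T t)"
  using T_bounded_clinear by (simp add: bounded_clinear_def)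

lemma T_positive: "t \<ge> 0 \<Longrightarrow> x \<in> P \<Longrightarrow> T t x \<in> P"
  using positive by (simp add: positive_semigroup_def)

lemma norm_T_le: "t \<ge> 0 \<Longrightarrow> norm (T t x) \<le> M\<^sub>\<omega> * exp (t * (\<omega> - 1)) * norm x"
  by (meson T_bounded_linear growth mult_right_mono norm_ge_zero onorm order_trans)

lemma S_bounded_linear: "t \<ge> 0 \<Longrightarrow> bounded_linear (S a t)"
  unfolding S_def[abs_def]
  by (intro bounded_linear_compose[OF bounded_linear_scaleR_right] T_bounded_linear)

lemma S_linear: "t \<ge> 0 \<Longrightarrow> linear (S a t)"
  by (rule bounded_linear.linear[OF S_bounded_linear])

lemma S_positive: "t \<ge> 0 \<Longrightarrow> x \<in> P \<Longrightarrow> S a t x \<in> P"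
  unfolding S_def by (intro P_scale T_positive) auto

lemma S_zero [simp]: "S a 0 x = x"
  using semigroup by (simp add: S_def C0_semigroup_def)

lemma S_add: "s \<ge> 0 \<Longrightarrow> t \<ge> 0 \<Longrightarrow> S a s (S a t x) = S a (s + t) x"
  using semigroup linear_scale[OF bounded_linear.linear[OF T_bounded_linear], of s]
  by (simp add: S_def C0_semigroup_def algebra_simps exp_add[symmetric])

lemma norm_S_le:
  assumes "t \<ge> 0"
  shows "norm (S a t x) \<le> M\<^sub>\<omega> * exp (t * (\<omega> - 1) - a * t) * norm x"
proof -
  have "norm (S a t x) \<le> exp (- (a * t)) * (M\<^sub>\<omega> * exp (t * (\<omega> - 1)) * norm x)"
    unfolding S_def norm_scaleR by (intro mult_mono norm_T_le assms) auto
  also have "\<dots> = M\<^sub>\<omega> * exp (t * (\<omega> - 1) - a * t) * norm x"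
    by (simp add: exp_diff exp_minus divide_inverse)
  finally show ?thesis .
qed

text \<open>The point \<open>- a\<close> lies in the left half-plane, and up to sign the resolvent of \<open>A\<close> there is
  \<open>(a + A)\<^sup>-\<^sup>1\<close>.\<close>

lemma Res_bij_and_bounded:
  assumes a: "a > 0"
  shows "bij_betw (\<lambda>x. a *\<^sub>R x + A x) D UNIV" and "bounded_linear (Res a)"
proof -
  define l :: complex where "l = - complex_of_real a"
  have l: "l *\<^sub>C x = - (a *\<^sub>R x)" for x :: 'a
    using scaleC_of_real[of "- a" x] by (simp add: l_def)
  have "l \<in> resolvent_set D A"
    using resolvent a by (auto simp: l_def)
  then have bij: "bij_betw (\<lambda>x. l *\<^sub>C x - A x) D UNIV"
    and bdd: "bounded_linear (inv_into D (\<lambda>x. l *\<^sub>C x - A x))"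
    by (auto simp: resolvent_set_def bounded_clinear_def)
  have eq: "(\<lambda>x. a *\<^sub>R x + A x) = uminus \<circ> (\<lambda>x. l *\<^sub>C x - A x)"
    by (auto simp: l)
  show b: "bij_betw (\<lambda>x. a *\<^sub>R x + A x) D UNIV"
    unfolding eq by (rule bij_betw_trans[OF bij]) (rule bij_uminus)
  have "Res a y = inv_into D (\<lambda>x. l *\<^sub>C x - A x) (- y)" for y
    unfolding Res_def scaleC_of_real
  proof (rule inv_into_f_eq)
    show "inj_on (\<lambda>x. a *\<^sub>R x + A x) D"
      using b by (rule bij_betw_imp_inj_on)
    have *: "- y \<in> (\<lambda>x. l *\<^sub>C x - A x) ` D"
      using bij by (simp add: bij_betw_def)
    show "inv_into D (\<lambda>x. l *\<^sub>C x - A x) (- y) \<in> D"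
      by (rule inv_into_into[OF *])
    show "a *\<^sub>R inv_into D (\<lambda>x. l *\<^sub>C x - A x) (- y) + A (inv_into D (\<lambda>x. l *\<^sub>C x - A x) (- y)) = y"
      using f_inv_into_f[OF *] by (simp add: l algebra_simps neg_eq_iff_add_eq_0 add_eq_0_iff)
  qed
  then have "Res a = inv_into D (\<lambda>x. l *\<^sub>C x - A x) \<circ> uminus"
    by auto
  then show "bounded_linear (Res a)"
    using bounded_linear_compose[OF bdd bounded_linear_minus[OF bounded_linear_ident]]
    by (simp add: comp_def)
qed

lemma Res_linear: "a > 0 \<Longrightarrow> linear (Res a)"
  by (rule bounded_linear.linear[OF Res_bij_and_bounded(2)])

lemma Res_in_D: "a > 0 \<Longrightarrow> Res a x \<in> D"
  and Res_right: "a > 0 \<Longrightarrow> a *\<^sub>R Res a x + A (Res a x) = x"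
  and Res_left: "a > 0 \<Longrightarrow> y \<in> D \<Longrightarrow> Res a (a *\<^sub>R y + A y) = y"
  using Res_bij_and_bounded(1)[of a]
    inv_into_into[of x "\<lambda>x. a *\<^sub>R x + A x" D] f_inv_into_f[of x "\<lambda>x. a *\<^sub>R x + A x" D]
    inv_into_f_f[of "\<lambda>x. a *\<^sub>R x + A x" D y]
  by (auto simp: Res_def scaleC_of_real bij_betw_def)

lemma norm_Res_le: "a > 0 \<Longrightarrow> norm (Res a x) \<le> g (1 / a) * norm x"
  using onorm[OF Res_bij_and_bounded(2)] g_bound unfolding Res_def
  by (meson mult_right_mono norm_ge_zero order_trans)

lemma generator_tendsto:
  "y \<in> D \<Longrightarrow> ((\<lambda>h. (T h y - y) /\<^sub>R h) \<longlongrightarrow> - A y) (at_right 0)"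
  using generator by (simp add: generator_def)

text \<open>The operator \<open>T t\<close> can be pulled out of the difference quotients that define the generator, so it
  maps \<open>D\<close> into itself and commutes with \<open>A\<close>.\<close>

lemma Res_commute:
  assumes a: "a > 0" and t: "t \<ge> 0"
  shows "S a t (Res a x) = Res a (S a t x)"
proof -
  note lin = bounded_linear.linear[OF T_bounded_linear[OF t]]
  define y where "y = Res a x"
  have y: "y \<in> D"
    unfolding y_def by (rule Res_in_D[OF a])
  have "((\<lambda>h. T t ((T h y - y) /\<^sub>R h)) \<longlongrightarrow> T t (- A y)) (at_right 0)"
    by (rule bounded_linear.tendsto[OF T_bounded_linear[OF t] generator_tendsto[OF y]])
  moreover have "\<forall>\<^sub>F h in at_right 0. T t ((T h y - y) /\<^sub>R h) = (T h (T t y) - T t y) /\<^sub>R h"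
    using eventually_at_right_less[of 0]
  proof eventually_elim
    fix h :: real assume h: "0 < h"
    have "T (t + h) = T t \<circ> T h" "T (h + t) = T h \<circ> T t"
      using semigroup t h by (simp_all add: C0_semigroup_def)
    then have "T t (T h y) = T h (T t y)"
      by (metis add.commute comp_apply)
    then show "T t ((T h y - y) /\<^sub>R h) = (T h (T t y) - T t y) /\<^sub>R h"
      by (simp add: linear_scale[OF lin] linear_diff[OF lin])
  qed
  ultimately have lim: "((\<lambda>h. (T h (T t y) - T t y) /\<^sub>R h) \<longlongrightarrow> T t (- A y)) (at_right 0)"
    using Lim_transform_eventually by fast
  then have D: "T t y \<in> D"
    using generator by (auto simp: generator_def)
  have "- A (T t y) = T t (- A y)"
    by (rule tendsto_unique[OF _ generator_tendsto[OF D] lim]) simp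
  then have "a *\<^sub>R T t y + A (T t y) = T t (a *\<^sub>R y + A y)"
    by (simp add: linear_add[OF lin] linear_scale[OF lin] linear_neg[OF lin])
  then have "T t y = Res a (T t x)"
    using Res_left[OF a D] Res_right[OF a, of x] by (simp add: y_def)
  then show ?thesis
    by (simp add: S_def y_def linear_scale[OF Res_linear[OF a]])
qed

text \<open>The generator of \<open>S a\<close> sends \<open>Res a x\<close> to \<open>- x\<close>.\<close>

lemma Res_difference_quotient:
  assumes a: "a > 0"
  shows "((\<lambda>h. (Res a x - S a h (Res a x)) /\<^sub>R h) \<longlongrightarrow> x) (at_right 0)"
proof -
  define y where "y = Res a x"
  have y: "y \<in> D"
    unfolding y_def by (rule Res_in_D[OF a])
  have "((\<lambda>h. exp (- (a * h))) has_field_derivative - a) (at 0)"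
    by (auto intro!: derivative_eq_intros)
  then have "((\<lambda>h. (exp (- (a * h)) - 1) / h) \<longlongrightarrow> - a) (at 0)"
    by (simp add: has_field_derivative_iff)
  then have e: "((\<lambda>h. (exp (- (a * h)) - 1) / h) \<longlongrightarrow> - a) (at_right 0)"
    by (rule filterlim_mono[OF _ order_refl]) (simp add: at_le)
  have "((\<lambda>h. - (exp (- (a * h)) *\<^sub>R ((T h y - y) /\<^sub>R h)) - ((exp (- (a * h)) - 1) / h) *\<^sub>R y)
      \<longlongrightarrow> - (exp (- (a * 0)) *\<^sub>R (- A y)) - (- a) *\<^sub>R y) (at_right 0)"
    by (intro tendsto_intros e generator_tendsto[OF y])
  moreover have "- (exp (- (a * 0)) *\<^sub>R (- A y)) - (- a) *\<^sub>R y = x"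
    using Res_right[OF a, of x] by (simp add: y_def add.commute)
  moreover have "- (exp (- (a * h)) *\<^sub>R ((T h y - y) /\<^sub>R h)) - ((exp (- (a * h)) - 1) / h) *\<^sub>R y
      = (y - S a h y) /\<^sub>R h" for h
    by (simp add: S_def algebra_simps divide_inverse)
  ultimately show ?thesis
    by (simp add: y_def)
qed

text \<open>\<open>V a h x\<close> is the integral of \<open>S a r x\<close> over \<open>r \<in> [0, h]\<close>. In this form
  additivity of the integral in the interval is a telescoping sum (lemma \<open>sum_S_V\<close>), and the quotients \<open>V a h x / h\<close> tend to \<open>x\<close> by the definition of
  the generator.\<close>

definition V :: "real \<Rightarrow> real \<Rightarrow> 'a \<Rightarrow> 'a"
  where "V a h x = Res a x - S a h (Res a x)"

lemma V_quotient_LIMSEQ: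
  assumes a: "a > 0" and c: "c > 0"
  shows "(\<lambda>n. (real (Suc n) / c) *\<^sub>R V a (c / real (Suc n)) x) \<longlonglongrightarrow> x"
proof -
  have "(\<lambda>n. c * (1 / real (Suc n))) \<longlonglongrightarrow> c * 0"
    using LIMSEQ_Suc[OF lim_1_over_n] by (intro tendsto_intros) auto
  then have "filterlim (\<lambda>n. c / real (Suc n)) (at_right 0) sequentially"
    using c by (intro filterlim_at_withinI) (auto intro!: always_eventually)
  from filterlim_compose[OF Res_difference_quotient[OF a] this]
  show ?thesis
    by (simp add: V_def)
qed

lemma V_linear: "a > 0 \<Longrightarrow> h \<ge> 0 \<Longrightarrow> linear (V a h)"
  unfolding V_def[abs_def]
  by (intro linear_compose_sub Res_linear linear_compose[OF Res_linear S_linear, unfolded comp_def])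

lemma V_commute:
  assumes "a > 0" "h \<ge> 0" "t \<ge> 0"
  shows "V a h (S a t x) = S a t (V a h x)"
proof -
  have "S a h (S a t (Res a x)) = S a t (S a h (Res a x))"
    using assms by (simp add: S_add add.commute)
  then show ?thesis
    using assms by (simp add: V_def Res_commute[of a t x, symmetric] linear_diff[OF S_linear])
qed

lemma sum_S_V:
  assumes "a > 0" "h \<ge> 0"
  shows "(\<Sum>j<n. S a (real j * h) (V a h x)) = Res a x - S a (real n * h) (Res a x)"
proof -
  have "S a (real j * h) (V a h x)
      = S a (real j * h) (Res a x) - S a (real (Suc j) * h) (Res a x)" for j
    using assms by (simp add: V_def linear_diff[OF S_linear] S_add algebra_simps)
  then show ?thesis
    using sum_lessThan_telescope'[of "\<lambda>j. S a (real j * h) (Res a x)" n] by simp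
qed

text \<open>Cutting \<open>[0, h]\<close> into \<open>n\<close> equal pieces of length \<open>\<delta>\<close> writes \<open>V a h x\<close> as the sum of the terms
  \<open>\<delta> S a (j \<delta>) d\<close>, where \<open>d = V a \<delta> x / \<delta>\<close> tends to \<open>x\<close>. It is therefore the limit of Riemann
  sums \<open>z n\<close> of the positive function \<open>S a r x\<close>, and the cone is closed.\<close>

lemma V_positive:
  assumes a: "a > 0" and h: "h \<ge> 0" and x: "x \<in> P"
  shows "V a h x \<in> P"
proof (cases "h = 0")
  case True
  then show ?thesis
    by (simp add: V_def zero_in_P)
next
  case False
  with h have h: "h > 0"
    by simp
  define K where "K = M\<^sub>\<omega> * exp (h * \<omega>)"
  define \<delta> where "\<delta> n = h / real (Suc n)" for n
  define d where "d n = (real (Suc n) / h) *\<^sub>R V a (\<delta> n) x" for n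
  define z where "z n = (\<Sum>j<Suc n. \<delta> n *\<^sub>R S a (real j * \<delta> n) x)" for n
  have \<delta>: "\<delta> n > 0" "real (Suc n) * \<delta> n = h" for n
    using h by (auto simp: \<delta>_def)
  have V_eq: "V a h x = (\<Sum>j<Suc n. \<delta> n *\<^sub>R S a (real j * \<delta> n) (d n))" for n
  proof -
    have "\<delta> n *\<^sub>R S a (real j * \<delta> n) (d n) = S a (real j * \<delta> n) (V a (\<delta> n) x)" for j
      using h \<delta>(1)[of n] by (simp add: d_def linear_scale[OF S_linear] \<delta>_def del: of_nat_Suc)
    then show ?thesis
      using sum_S_V[of a "\<delta> n" x "Suc n"] a \<delta>[of n] by (simp add: V_def del: sum.lessThan_Suc)
  qed
  have S_bound: "norm (S a (real j * \<delta> n) y) \<le> K * norm y" if "j < Suc n" for j n y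
  proof -
    have "real j * \<delta> n \<le> real (Suc n) * \<delta> n"
      using that \<delta>(1)[of n] by (intro mult_right_mono) auto
    then have jh: "real j * \<delta> n \<le> h"
      using \<delta>(2)[of n] by simp
    have "real j * \<delta> n * (\<omega> - 1) - a * (real j * \<delta> n) \<le> real j * \<delta> n * \<omega>"
      using a \<delta>(1)[of n] by (simp add: algebra_simps)
    also have "\<dots> \<le> h * \<omega>"
      using \<omega> by (intro mult_right_mono jh) auto
    finally have "M\<^sub>\<omega> * exp (real j * \<delta> n * (\<omega> - 1) - a * (real j * \<delta> n)) * norm y \<le> K * norm y"
      unfolding K_def using M\<omega> by (intro mult_right_mono mult_left_mono) auto
    then show ?thesis
      using norm_S_le[of "real j * \<delta> n" a y] \<delta>(1)[of n] by simp
  qed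
  have bound: "norm (z n - V a h x) \<le> h * K * norm (x - d n)" for n
  proof -
    have "z n - V a h x = (\<Sum>j<Suc n. \<delta> n *\<^sub>R S a (real j * \<delta> n) (x - d n))"
      unfolding z_def V_eq[of n] sum_subtractf[symmetric]
      using \<delta>(1)[of n] by (intro sum.cong) (simp_all add: linear_diff[OF S_linear] algebra_simps)
    also have "norm \<dots> \<le> (\<Sum>j<Suc n. \<delta> n * (K * norm (x - d n)))"
      using \<delta>(1)[of n] by (intro sum_norm_le) (simp add: S_bound)
    also have "\<dots> = h * K * norm (x - d n)"
      using \<delta>(2)[of n] by simp
    finally show ?thesis .
  qed
  have "d \<longlonglongrightarrow> x"
    using V_quotient_LIMSEQ[OF a h] by (simp add: d_def[abs_def] \<delta>_def)
  then have "(\<lambda>n. h * K * norm (x - d n)) \<longlonglongrightarrow> h * K * norm (x - x)"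
    by (intro tendsto_intros)
  then have "(\<lambda>n. norm (z n - V a h x)) \<longlonglongrightarrow> 0"
    by (intro Lim_null_comparison[of "\<lambda>n. norm (z n - V a h x)"]) (use bound in auto)
  then have "z \<longlonglongrightarrow> V a h x"
    by (metis LIM_zero_cancel tendsto_norm_zero_iff)
  moreover have "z n \<in> P" for n
    unfolding z_def using \<delta>(1)[of n] by (intro P_sum P_scale S_positive x) auto
  ultimately show ?thesis
    using closed_sequentially[OF closed_P] by blast
qed

text \<open>For such \<open>a\<close> the semigroup \<open>S a\<close> decays exponentially, so the resolvent is the limit of the
  positive operators \<open>V a n\<close>.\<close>

lemma Res_positive_of_ge:
  assumes a: "a \<ge> \<omega>" and x: "x \<in> P"
  shows "Res a x \<in> P"
proof -
  have a0: "a > 0"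
    using \<omega> a by simp
  have "norm (S a (real n) y) \<le> M\<^sub>\<omega> * norm y * exp (- 1) ^ n" for n y
  proof -
    have "real n * (\<omega> - 1) - a * real n \<le> - real n"
      using mult_left_mono[OF a, of "real n"] by (simp add: algebra_simps)
    then have "M\<^sub>\<omega> * exp (real n * (\<omega> - 1) - a * real n) * norm y \<le> M\<^sub>\<omega> * exp (- real n) * norm y"
      using M\<omega> by (intro mult_right_mono mult_left_mono) auto
    then show ?thesis
      using norm_S_le[of "real n" a y] by (simp add: mult_ac exp_of_nat_mult[symmetric])
  qed
  moreover have "(\<lambda>n. M\<^sub>\<omega> * norm (Res a x) * exp (- 1) ^ n) \<longlonglongrightarrow> M\<^sub>\<omega> * norm (Res a x) * 0"
    by (intro tendsto_intros LIMSEQ_power_zero) auto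
  ultimately have "(\<lambda>n. S a (real n) (Res a x)) \<longlonglongrightarrow> 0"
    by (intro Lim_null_comparison[of "\<lambda>n. S a (real n) (Res a x)"]) auto
  then have "(\<lambda>n. V a (real n) x) \<longlonglongrightarrow> Res a x - 0"
    unfolding V_def by (intro tendsto_intros)
  then show ?thesis
    using closed_sequentially[OF closed_P, of "\<lambda>n. V a (real n) x"] V_positive[OF a0 _ x] by auto
qed

lemma Res_identity:
  assumes "l > 0" "a > 0"
  shows "Res a x = Res l (x + (l - a) *\<^sub>R Res a x)"
proof -
  have "l *\<^sub>R Res a x + A (Res a x) = x + (l - a) *\<^sub>R Res a x"
    using Res_right[OF assms(2), of x] by (simp add: algebra_simps)
  then show ?thesis
    using Res_left[OF assms(1) Res_in_D[OF assms(2)], of x] by simp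
qed

text \<open>By the resolvent identity \<open>Res a x\<close> is the fixed point of the map sending \<open>y\<close> to
  \<open>Res l (x + (l - a) y)\<close>. This map preserves the cone and contracts distances by a factor \<open>1/2\<close>, so
  its iterates starting from \<open>0\<close> stay in the cone and converge to \<open>Res a x\<close>.\<close>

lemma Res_positive_step:
  assumes l: "l > 0" and a: "a > 0" and "a \<le> l" and close: "(l - a) * g (1 / l) \<le> 1 / 2"
    and pos: "\<And>x. x \<in> P \<Longrightarrow> Res l x \<in> P" and x: "x \<in> P"
  shows "Res a x \<in> P"
proof -
  note lin = Res_linear[OF l]
  define z where "z n = ((\<lambda>y. Res l (x + (l - a) *\<^sub>R y)) ^^ n) 0" for n
  have z: "z n \<in> P \<and> norm (z n - Res a x) \<le> (1 / 2) ^ n * norm (Res a x)" for n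
  proof (induction n)
    case 0
    then show ?case
      by (simp add: z_def zero_in_P)
  next
    case (Suc n)
    have zS: "z (Suc n) = Res l (x + (l - a) *\<^sub>R z n)"
      by (simp add: z_def)
    have "z (Suc n) \<in> P"
      unfolding zS using Suc \<open>a \<le> l\<close> x by (intro pos P_add P_scale) auto
    moreover have "norm (z (Suc n) - Res a x) \<le> (1 / 2) ^ Suc n * norm (Res a x)"
    proof -
      have "z (Suc n) - Res a x = Res l ((l - a) *\<^sub>R (z n - Res a x))"
        unfolding zS using Res_identity[OF l a, of x]
        by (metis (no_types, lifting) add_diff_cancel_left linear_diff[OF lin] scaleR_right_diff_distrib)
      also have "norm \<dots> \<le> g (1 / l) * ((l - a) * norm (z n - Res a x))"
        using norm_Res_le[OF l, of "(l - a) *\<^sub>R (z n - Res a x)"] \<open>a \<le> l\<close> by simp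
      also have "\<dots> = ((l - a) * g (1 / l)) * norm (z n - Res a x)"
        by simp
      also have "\<dots> \<le> (1 / 2) * ((1 / 2) ^ n * norm (Res a x))"
        using close Suc by (intro mult_mono) auto
      finally show ?thesis
        by simp
    qed
    ultimately show ?case ..
  qed
  have "(\<lambda>n. (1 / 2) ^ n * norm (Res a x)) \<longlonglongrightarrow> 0 * norm (Res a x)"
    by (intro tendsto_intros LIMSEQ_power_zero) auto
  then have "(\<lambda>n. z n - Res a x) \<longlonglongrightarrow> 0"
    by (intro Lim_null_comparison[of "\<lambda>n. z n - Res a x"]) (use z in auto)
  then have "z \<longlonglongrightarrow> Res a x"
    by (rule LIM_zero_cancel)
  then show ?thesis
    using closed_sequentially[OF closed_P, of z] z by blast
qed

text \<open>Since \<open>g\<close> is nondecreasing, the resolvents at all points of \<open>[a, \<infinity>)\<close> have norm at most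
  \<open>g (1 / a)\<close>. Positivity can hence be carried down to \<open>a\<close> in finitely many steps of one fixed
  length, starting where the semigroup decays.\<close>

lemma Res_positive:
  assumes a: "a > 0" and x: "x \<in> P"
  shows "Res a x \<in> P"
proof -
  \<comment> \<open>The step length for which the contraction factor is at most \<open>1/2\<close> above \<open>a\<close>.\<close>
  define \<delta> where "\<delta> = 1 / (2 * g (1 / a))"
  define L where "L = max a \<omega>"
  have ga: "g (1 / a) > 0"
    using g_pos a by simp
  then have \<delta>: "\<delta> > 0"
    by (simp add: \<delta>_def)
  have step: "\<forall>y\<in>P. Res (max a (L - real n * \<delta>)) y \<in> P" for n
  proof (induction n)
    case 0
    then show ?case
      using Res_positive_of_ge by (simp add: L_def)
  next
    case (Suc n)
    define l where "l = max a (L - real n * \<delta>)"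
    define b where "b = max a (L - real (Suc n) * \<delta>)"
    have l: "l > 0" "a \<le> l" and b: "b > 0"
      using a by (auto simp: l_def b_def)
    have bl: "b \<le> l" "l - b \<le> \<delta>"
      using \<delta> by (auto simp: l_def b_def max_def algebra_simps)
    have "g (1 / l) \<le> g (1 / a)"
      using a l by (intro mono_onD[OF g_mono]) (auto simp: field_simps)
    then have "(l - b) * g (1 / l) \<le> \<delta> * g (1 / a)"
      using bl ga g_pos[of "1 / l"] l \<delta> by (intro mult_mono) auto
    then have "(l - b) * g (1 / l) \<le> 1 / 2"
      using ga by (simp add: \<delta>_def)
    then show ?case
      using Res_positive_step[OF l(1) b bl(1)] Suc.IH unfolding l_def b_def by blast
  qed
  obtain n where "L < real n * \<delta>"
    using reals_Archimedean3[OF \<delta>] by blast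
  then have "max a (L - real n * \<delta>) = a"
    using a by (simp add: max_def)
  then show ?thesis
    using step[of n] x by metis
qed

end


section \<open>A discrete convolution inequality\<close>

lemma sum_convolution_reindex:
  fixes G :: "nat \<Rightarrow> nat \<Rightarrow> 'b::comm_monoid_add"
  shows "(\<Sum>k<n. \<Sum>i\<le>k. G i (k - i)) = (\<Sum>j<n. \<Sum>i<n - j. G i j)"
proof -
  have "(\<Sum>j<n. \<Sum>i<n - j. G i j) = (\<Sum>(j, i)\<in>Sigma {..<n} (\<lambda>j. {..<n - j}). G i j)"
    by (rule sum.Sigma) auto
  also have "\<dots> = (\<Sum>(i, j)\<in>{(i, j). i + j < n}. G i j)"
    by (rule sum.reindex_bij_witness[of _ "\<lambda>(i, j). (j, i)" "\<lambda>(i, j). (j, i)"]) auto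
  finally show ?thesis
    by (simp add: sum.triangle_reindex)
qed

context positive_C0_semigroup
begin

text \<open>The operators \<open>K j = S a (j h) V a h\<close> are positive and sum to at most \<open>Res a\<close>. Pairing the
  convolution of \<open>K\<close> with \<open>f\<close> against the weights \<open>b\<close> and collecting the terms with the same \<open>K j\<close>
  gives the sum of \<open>K j\<close> applied to combinations of the \<open>f i\<close>, each of which is at most \<open>F\<close>. So the
  pairing is at most \<open>Res a F\<close>, whatever the step \<open>h\<close> and the number of terms.\<close>

lemma convolution_dominated:
  assumes a: "a > 0" and h: "h \<ge> 0" and F: "F \<in> P"
    and dom: "\<And>j. j < n \<Longrightarrow> F - (\<Sum>i<n - j. b (i + j) *\<^sub>R f i) \<in> P"
  shows "Res a F - (\<Sum>k<n. b k *\<^sub>R (\<Sum>i\<le>k. S a (real (k - i) * h) (V a h (f i)))) \<in> P"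
proof -
  define E where "E j = F - (\<Sum>i<n - j. b (i + j) *\<^sub>R f i)" for j
  define K where "K j y = S a (real j * h) (V a h y)" for j y
  have K: "linear (K j)" for j
    unfolding K_def[abs_def]
    using a h by (intro linear_compose[OF V_linear S_linear, unfolded comp_def]) auto
  have "(\<Sum>k<n. b k *\<^sub>R (\<Sum>i\<le>k. K (k - i) (f i)))
      = (\<Sum>k<n. \<Sum>i\<le>k. b (i + (k - i)) *\<^sub>R K (k - i) (f i))"
    by (intro sum.cong) (simp_all add: scaleR_sum_right)
  also have "\<dots> = (\<Sum>j<n. \<Sum>i<n - j. b (i + j) *\<^sub>R K j (f i))"
    by (rule sum_convolution_reindex)
  also have "\<dots> = (\<Sum>j<n. K j (\<Sum>i<n - j. b (i + j) *\<^sub>R f i))"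
    by (simp add: linear_sum[OF K] linear_scale[OF K])
  also have "\<dots> = (\<Sum>j<n. K j F) - (\<Sum>j<n. K j (E j))"
    by (simp add: E_def linear_diff[OF K] sum_subtractf)
  also have "(\<Sum>j<n. K j F) = Res a F - S a (real n * h) (Res a F)"
    unfolding K_def by (rule sum_S_V[OF a h])
  finally have "Res a F - (\<Sum>k<n. b k *\<^sub>R (\<Sum>i\<le>k. K (k - i) (f i)))
      = S a (real n * h) (Res a F) + (\<Sum>j<n. K j (E j))"
    by simp
  moreover have "K j (E j) \<in> P" if "j < n" for j
    using dom[OF that] a h unfolding K_def E_def by (intro S_positive V_positive) auto
  moreover have "S a (real n * h) (Res a F) \<in> P"
    using h by (intro S_positive Res_positive a F) auto
  ultimately show ?thesis
    unfolding K_def by (auto intro!: P_add P_sum)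
qed

text \<open>The convolution of a semigroup with its own orbit, damped by \<open>exp (- \<omega> s)\<close>, is again a multiple of
  the orbit. The multiple is \<open>(1 - exp (- \<omega> s)) / \<omega>\<close> in continuous time and \<open>h * weight h k\<close> at
  \<open>s = k h\<close> for step \<open>h\<close>. The damping makes the input of the convolution small, so that a bound on
  the output is a bound on the orbit itself.\<close>

definition damped_orbit :: "real \<Rightarrow> real \<Rightarrow> 'a \<Rightarrow> nat \<Rightarrow> 'a"
  where "damped_orbit a h x i = exp (- (\<omega> * h)) ^ i *\<^sub>R S a (real i * h) x"

definition weight :: "real \<Rightarrow> nat \<Rightarrow> real"
  where "weight h k = (\<Sum>i\<le>k. exp (- (\<omega> * h)) ^ i)"

lemma damped_orbit_positive: "h \<ge> 0 \<Longrightarrow> x \<in> P \<Longrightarrow> damped_orbit a h x i \<in> P"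
  unfolding damped_orbit_def by (intro P_scale S_positive) auto

text \<open>The damping turns the growth rate \<open>\<omega> - 1\<close> of the semigroup into a decay rate of at least \<open>1\<close>.\<close>

lemma norm_damped_orbit_le:
  assumes "a > 0" "h \<ge> 0"
  shows "norm (damped_orbit a h x i) \<le> exp (- h) ^ i * (M\<^sub>\<omega> * norm x)"
proof -
  have "norm (damped_orbit a h x i)
      \<le> exp (- (\<omega> * h)) ^ i * (M\<^sub>\<omega> * exp (real i * h * (\<omega> - 1) - a * (real i * h)) * norm x)"
    unfolding damped_orbit_def norm_scaleR
    using norm_S_le[of "real i * h" a x] assms by (intro mult_mono) auto
  also have "\<dots> = exp (- (real i * h) - a * (real i * h)) * (M\<^sub>\<omega> * norm x)"
    by (simp add: exp_of_nat_mult[symmetric] exp_add[symmetric] algebra_simps)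
  also have "\<dots> \<le> exp (- (real i * h)) * (M\<^sub>\<omega> * norm x)"
    using assms M\<omega> by (intro mult_right_mono) auto
  finally show ?thesis
    by (simp add: exp_of_nat_mult[symmetric])
qed

lemma convolution_damped_orbit:
  assumes "a > 0" "h \<ge> 0"
  shows "(\<Sum>i\<le>k. S a (real (k - i) * h) (V a h (damped_orbit a h x i)))
    = weight h k *\<^sub>R S a (real k * h) (V a h x)"
proof -
  have "S a (real (k - i) * h) (V a h (damped_orbit a h x i))
      = exp (- (\<omega> * h)) ^ i *\<^sub>R S a (real k * h) (V a h x)" if "i \<le> k" for i
  proof -
    have "real (k - i) * h + real i * h = real k * h"
      using that by (simp add: of_nat_diff algebra_simps)
    then show ?thesis
      using assms S_add[of "real (k - i) * h" "real i * h" a "V a h x"]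
      by (simp add: damped_orbit_def linear_scale[OF V_linear] linear_scale[OF S_linear] V_commute)
  qed
  then show ?thesis
    by (simp add: weight_def scaleR_sum_left)
qed

text \<open>The geometric sum \<open>h * weight h k\<close> is an upper Riemann sum of \<open>exp (- \<omega> s)\<close> over
  \<open>[0, (k + 1) h]\<close>.\<close>

lemma weight_ge:
  assumes h: "h > 0"
  shows "(1 - exp (- (\<omega> * (real (Suc k) * h)))) / \<omega> \<le> h * weight h k"
proof -
  define q where "q = exp (- (\<omega> * h))"
  have \<omega>0: "\<omega> > 0"
    using \<omega> by simp
  then have q: "q < 1" "q > 0"
    using h by (auto simp: q_def)
  have "1 - q \<le> \<omega> * h"
    using exp_ge_add_one_self[of "- (\<omega> * h)"] by (simp add: q_def)
  then have "1 / \<omega> \<le> h / (1 - q)"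
    using q \<omega>0 by (simp add: field_simps)
  moreover have "q ^ Suc k \<le> 1"
    using q by (intro power_le_one) auto
  ultimately have "(1 - q ^ Suc k) * (1 / \<omega>) \<le> (1 - q ^ Suc k) * (h / (1 - q))"
    by (intro mult_left_mono) auto
  also have "\<dots> = h * weight h k"
    using q(1) sum_gp[of q 0 k] by (simp add: weight_def q_def[symmetric] atLeast0AtMost)
  finally have "(1 - q ^ Suc k) / \<omega> \<le> h * weight h k"
    by simp
  moreover have "exp (- (\<omega> * (real (Suc k) * h))) = q ^ Suc k"
    unfolding q_def exp_of_nat_mult[symmetric] by (simp add: mult_ac)
  ultimately show ?thesis
    by simp
qed


section \<open>From resolvent bounds to growth bounds\<close>

text \<open>The exponential factor in \<open>S (1 / t) t\<close> is \<open>exp (- 1)\<close>; this is where the constant \<open>e\<close> comes from,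
  and the choice \<open>a = 1 / t\<close> turns \<open>g (1 / a)\<close> into \<open>g t\<close>.\<close>

lemma onorm_le_on_positive:
  assumes t: "t > 0" and C: "C \<ge> 0"
    and S: "\<And>x. x \<in> P \<Longrightarrow> norm (S (1 / t) t x) \<le> C * norm x"
  shows "onorm (T t) \<le> exp 1 * C"
proof (rule onorm_bound)
  fix z
  show "norm (T t z) \<le> exp 1 * C * norm z"
  proof (rule positive_operator_norm_bound)
    fix x assume x: "x \<in> P"
    have "norm (T t x) = exp 1 * norm (S (1 / t) t x)"
      using t by (simp add: S_def exp_minus)
    also have "\<dots> \<le> exp 1 * (C * norm x)"
      by (intro mult_left_mono S x) auto
    finally show "norm (T t x) \<le> exp 1 * C * norm x"
      by simp
  qed (use t T_bounded_clinear T_positive in auto)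
qed (use C in simp)

text \<open>The case where positive vectors of norm at most \<open>B\<close> have a common upper bound of norm at most \<open>B\<close>.
  Let \<open>F\<close> be such a bound for the damped orbit up to time \<open>t\<close>, with \<open>h = t / k\<close>. The last term of
  the convolution is below \<open>Res a F\<close>; as \<open>k\<close> grows, this becomes
  \<open>(1 - exp (- \<omega> t)) \<parallel>S a t x\<parallel> \<le> \<omega> g(t) M\<^sub>\<omega> \<parallel>x\<parallel>\<close>. The missing multiple \<open>exp (- \<omega> t)\<close> of
  \<open>\<parallel>S a t x\<parallel>\<close> is at most \<open>M\<^sub>\<omega> \<parallel>x\<parallel>\<close> by the growth assumption.\<close>

proposition growth_if_dominated:
  assumes dom: "\<And>(f :: nat \<Rightarrow> 'a) n B. B \<ge> 0 \<Longrightarrow> (\<And>i. i < n \<Longrightarrow> f i \<in> P \<and> norm (f i) \<le> B) \<Longrightarrow>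
      \<exists>F\<in>P. norm F \<le> B \<and> (\<forall>i<n. F - f i \<in> P)"
    and t: "t > 0"
  shows "onorm (T t) \<le> exp 1 * M\<^sub>\<omega> * (1 + \<omega>) * (g t + 1)"
proof -
  define a where "a = 1 / t"
  have a: "a > 0" "1 / a = t"
    using t by (auto simp: a_def)
  have gt: "g t > 0" and \<omega>0: "\<omega> > 0"
    using t g_pos \<omega> by auto
  have "norm (S a t x) \<le> M\<^sub>\<omega> * (1 + \<omega> * g t) * norm x" if x: "x \<in> P" for x
  proof -
    have discrete: "(1 - exp (- (\<omega> * t))) / \<omega>
        * norm (S a t ((real (Suc m) / t) *\<^sub>R V a (t / real (Suc m)) x)) \<le> g t * (M\<^sub>\<omega> * norm x)" for m
    proof -
      define k where "k = Suc m"
      define h where "h = t / real k"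
      define f where "f = damped_orbit a h x"
      have h: "h > 0" and kh: "real k * h = t"
        using t by (auto simp: h_def k_def)
      have "norm (f i) \<le> M\<^sub>\<omega> * norm x" for i
      proof -
        have "norm (f i) \<le> exp (- h) ^ i * (M\<^sub>\<omega> * norm x)"
          unfolding f_def using norm_damped_orbit_le a h by simp
        also have "\<dots> \<le> 1 * (M\<^sub>\<omega> * norm x)"
          using h M\<omega> by (intro mult_right_mono power_le_one) auto
        finally show ?thesis
          by simp
      qed
      then obtain F where F: "F \<in> P" "norm F \<le> M\<^sub>\<omega> * norm x" and Ff: "\<And>i. i < Suc k \<Longrightarrow> F - f i \<in> P"
        using dom[of "M\<^sub>\<omega> * norm x" "Suc k" f] damped_orbit_positive[of h x a] h x M\<omega>
        by (auto simp: f_def)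
      \<comment> \<open>The weights single out the last term of the convolution.\<close>
      define b :: "nat \<Rightarrow> real" where "b i = (if i = k then 1 else 0)" for i
      have "F - (\<Sum>i<Suc k - j. b (i + j) *\<^sub>R f i) \<in> P" if "j < Suc k" for j
      proof -
        have "(\<Sum>i<Suc k - j. b (i + j) *\<^sub>R f i) = (\<Sum>i\<in>{k - j}. b (i + j) *\<^sub>R f i)"
          using that by (intro sum.mono_neutral_right) (auto simp: b_def)
        then show ?thesis
          using that Ff[of "k - j"] by (simp add: b_def)
      qed
      from convolution_dominated[where n = "Suc k" and b = b and f = f, OF a(1) less_imp_le[OF h] F(1) this]
      have "Res a F - weight h k *\<^sub>R S a t (V a h x) \<in> P"
        using convolution_damped_orbit[OF a(1) less_imp_le[OF h], of k x] kh
        by (simp add: f_def b_def)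
      moreover have w: "weight h k \<ge> 0"
        by (simp add: weight_def sum_nonneg)
      ultimately have "norm (weight h k *\<^sub>R S a t (V a h x)) \<le> norm (Res a F)"
        using a h t x by (intro norm_mono_positive P_scale S_positive V_positive) auto
      also have "\<dots> \<le> g t * norm F"
        using norm_Res_le[OF a(1), of F] a(2) by simp
      also have "\<dots> \<le> g t * (M\<^sub>\<omega> * norm x)"
        using F(2) gt by (intro mult_left_mono) auto
      finally have u: "weight h k * norm (S a t (V a h x)) \<le> g t * (M\<^sub>\<omega> * norm x)"
        using w by simp
      have "(1 - exp (- (\<omega> * t))) / \<omega> \<le> (1 - exp (- (\<omega> * (real (Suc k) * h)))) / \<omega>"
        using kh h \<omega>0 by (intro divide_right_mono) (auto simp: algebra_simps)
      also have "\<dots> \<le> h * weight h k"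
        by (rule weight_ge[OF h])
      finally have "(1 - exp (- (\<omega> * t))) / \<omega> * norm (S a t ((1 / h) *\<^sub>R V a h x))
          \<le> h * weight h k * norm (S a t ((1 / h) *\<^sub>R V a h x))"
        by (intro mult_right_mono) auto
      also have "\<dots> = weight h k * norm (S a t (V a h x))"
        using h t by (simp add: linear_scale[OF S_linear])
      finally show ?thesis
        using u by (simp add: h_def k_def)
    qed
    have "(\<lambda>m. (1 - exp (- (\<omega> * t))) / \<omega>
        * norm (S a t ((real (Suc m) / t) *\<^sub>R V a (t / real (Suc m)) x)))
        \<longlonglongrightarrow> (1 - exp (- (\<omega> * t))) / \<omega> * norm (S a t x)"
      by (intro tendsto_intros bounded_linear.tendsto[OF S_bounded_linear] V_quotient_LIMSEQ a t
          less_imp_le[OF t])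
    then have "(1 - exp (- (\<omega> * t))) / \<omega> * norm (S a t x) \<le> g t * (M\<^sub>\<omega> * norm x)"
      by (rule LIMSEQ_le_const2) (use discrete in auto)
    then have "(1 - exp (- (\<omega> * t))) * norm (S a t x) \<le> \<omega> * (g t * (M\<^sub>\<omega> * norm x))"
      using \<omega>0 by (simp add: field_simps)
    moreover have "exp (- (\<omega> * t)) * norm (S a t x) \<le> M\<^sub>\<omega> * norm x"
    proof -
      have "exp (- (\<omega> * t)) * norm (S a t x) = norm (damped_orbit a t x 1)"
        by (simp add: damped_orbit_def)
      also have "\<dots> \<le> exp (- t) ^ 1 * (M\<^sub>\<omega> * norm x)"
        using t by (intro norm_damped_orbit_le a) auto
      also have "\<dots> \<le> 1 * (M\<^sub>\<omega> * norm x)"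
        using t M\<omega> by (intro mult_right_mono) auto
      finally show ?thesis
        by simp
    qed
    ultimately show ?thesis
      by (simp add: algebra_simps)
  qed
  then have "onorm (T t) \<le> exp 1 * (M\<^sub>\<omega> * (1 + \<omega> * g t))"
    using t M\<omega> \<omega>0 gt by (intro onorm_le_on_positive) (auto simp: a_def)
  also have "\<dots> \<le> exp 1 * (M\<^sub>\<omega> * ((1 + \<omega>) * (g t + 1)))"
    using M\<omega> \<omega>0 gt by (intro mult_left_mono) (auto simp: algebra_simps)
  finally show ?thesis
    by (simp add: mult_ac)
qed

text \<open>The set \<open>\<B> n\<close> plays the part of the positive unit ball of the dual of \<open>n\<close>-dimensional \<open>\<ell>\<^sup>p\<close>: the
  two hypotheses on it say that the pointwise \<open>\<ell>\<^sup>p\<close> norm of finitely many positive vectors exists in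
  the space, as a vector dominating all their pairings with weights in \<open>\<B> n\<close>, and that it is
  determined by these pairings. Applied to the damped orbit \<open>f\<close>, the convolution inequality then
  bounds the \<open>\<ell>\<^sup>p\<close> sum of the norms of the convolution \<open>u\<close> by \<open>g(t)\<close> times that of \<open>f\<close>.

  To return to a pointwise bound, let \<open>t > 2\<close> and step \<open>h = 1 / l\<close>. There are \<open>l\<close> indices \<open>k\<close> with
  \<open>k h\<close> within distance \<open>1\<close> below \<open>t\<close>, and for each of them \<open>\<parallel>S a t (V a h x)\<parallel>\<close> is at most
  \<open>2 \<omega> h M \<parallel>u k\<parallel>\<close>. Averaging over them and letting \<open>h\<close> tend to \<open>0\<close> bounds \<open>\<parallel>S a t x\<parallel>\<close>. For
  \<open>t \<le> 2\<close> the norm is at most \<open>M\<close>.\<close>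

proposition growth_if_p_dominated:
  fixes p M t :: real and \<B> :: "nat \<Rightarrow> (nat \<Rightarrow> real) set"
  assumes p: "p \<ge> 1"
    and dom: "\<And>f n. (\<And>i. i < n \<Longrightarrow> f i \<in> P) \<Longrightarrow>
      \<exists>F\<in>P. norm F powr p = (\<Sum>i<n. norm (f i) powr p) \<and>
        (\<forall>b\<in>\<B> n. \<forall>j<n. F - (\<Sum>i<n - j. b (i + j) *\<^sub>R f i) \<in> P)"
    and codom: "\<And>u G n. (\<And>k. k < n \<Longrightarrow> u k \<in> P) \<Longrightarrow> G \<in> P \<Longrightarrow>
      (\<And>b. b \<in> \<B> n \<Longrightarrow> G - (\<Sum>k<n. b k *\<^sub>R u k) \<in> P) \<Longrightarrow>
      (\<Sum>k<n. norm (u k) powr p) \<le> norm G powr p"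
    and M: "\<And>r. 0 \<le> r \<Longrightarrow> r \<le> 2 \<Longrightarrow> onorm (T r) \<le> M"
    and t: "t > 0"
  shows "onorm (T t) \<le> exp 1 * M\<^sub>\<omega> * (1 + 2 * M * \<omega>) * (g t + 1)"
proof -
  define a where "a = 1 / t"
  have a: "a > 0" "1 / a = t"
    using t by (auto simp: a_def)
  have gt: "g t > 0" and \<omega>0: "\<omega> > 0"
    using t g_pos \<omega> by auto
  have M0: "M \<ge> 0"
    using M[of 0] onorm_pos_le[OF T_bounded_linear[of 0]] by simp
  have SM: "norm (S a r y) \<le> M * norm y" if "0 \<le> r" "r \<le> 2" for r y
  proof -
    have "norm (S a r y) \<le> 1 * (onorm (T r) * norm y)"
      unfolding S_def norm_scaleR using that a
      by (intro mult_mono onorm[OF T_bounded_linear]) (auto simp: onorm_pos_le T_bounded_linear)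
    also have "\<dots> \<le> M * norm y"
      using M[OF that] by (simp add: mult_right_mono)
    finally show ?thesis .
  qed
  show ?thesis
  proof (cases "t \<le> 2")
    case True
    have "onorm (T t) \<le> 1 * 1 * (1 + 2 * M * \<omega>) * 1"
      using M[of t] t True \<omega> mult_left_mono[OF \<omega> M0] M0 by simp
    also have "\<dots> \<le> exp 1 * M\<^sub>\<omega> * (1 + 2 * M * \<omega>) * (g t + 1)"
      using M\<omega> M0 \<omega>0 gt by (intro mult_mono) auto
    finally show ?thesis .
  next
    case False
    have "norm (S a t x) \<le> 2 * \<omega> * M * (g t * (M\<^sub>\<omega> * norm x))" (is "_ \<le> ?B") if x: "x \<in> P" for x
    proof -
      have B0: "?B \<ge> 0"
        using \<omega>0 M0 gt M\<omega> by simp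
      have discrete: "norm (S a t ((real (Suc m) / 1) *\<^sub>R V a (1 / real (Suc m)) x)) powr p
          \<le> ?B powr p * (1 + 1 / real (Suc m))" for m
      proof -
        define l where "l = Suc m"
        define h where "h = 1 / real l"
        \<comment> \<open>The time \<open>K h\<close> is the last point of the grid not after \<open>t\<close>.\<close>
        define K where "K = nat \<lfloor>t * real l\<rfloor>"
        define f where "f = damped_orbit a h x"
        define u where "u k = weight h k *\<^sub>R S a (real k * h) (V a h x)" for k
        have h: "h > 0" "h \<ge> 0" "real l * h = 1" and l: "l > 0"
          by (auto simp: h_def l_def)
        have "t * real l \<ge> 0"
          using t by simp
        then have K: "real K \<le> t * real l" "t * real l < real K + 1"
          unfolding K_def by linarith+
        have "2 * real l \<le> t * real l"
          using False by (intro mult_right_mono) auto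
        then have lK: "l \<le> K"
          using K by linarith
        have w: "weight h k \<ge> 0" for k
          by (simp add: weight_def sum_nonneg)
        have uP: "u k \<in> P" for k
          unfolding u_def using a h x w by (intro P_scale S_positive V_positive) auto
        have fP: "f i \<in> P" for i
          unfolding f_def using h x by (intro damped_orbit_positive) auto
        obtain F where F: "F \<in> P" "norm F powr p = (\<Sum>i<Suc K. norm (f i) powr p)"
          and Ff: "\<And>b j. b \<in> \<B> (Suc K) \<Longrightarrow> j < Suc K \<Longrightarrow>
            F - (\<Sum>i<Suc K - j. b (i + j) *\<^sub>R f i) \<in> P"
          using dom[of "Suc K" f] fP by blast
        have "(\<Sum>k<Suc K. norm (u k) powr p) \<le> norm (Res a F) powr p"
        proof (rule codom[OF uP Res_positive[OF a(1) F(1)]])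
          fix b assume "b \<in> \<B> (Suc K)"
          from convolution_dominated[where n = "Suc K" and b = b and f = f, OF a(1) h(2) F(1) Ff[OF this]]
          show "Res a F - (\<Sum>k<Suc K. b k *\<^sub>R u k) \<in> P"
            unfolding f_def convolution_damped_orbit[OF a(1) h(2)] u_def by simp
        qed
        also have "\<dots> \<le> (g t * norm F) powr p"
          using norm_Res_le[OF a(1), of F] p a(2) by (intro powr_mono2) auto
        also have "\<dots> = g t powr p * (\<Sum>i<Suc K. norm (f i) powr p)"
          using gt F(2) by (simp add: powr_mult)
        also have "\<dots> \<le> g t powr p * ((M\<^sub>\<omega> * norm x) powr p * ((1 + h) / h))"
        proof (intro mult_left_mono)
          have "(\<Sum>i<Suc K. norm (f i) powr p) \<le> (\<Sum>i<Suc K. exp (- h) ^ i * (M\<^sub>\<omega> * norm x) powr p)"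
          proof (rule sum_mono)
            fix i
            have "norm (f i) powr p \<le> (exp (- h) ^ i * (M\<^sub>\<omega> * norm x)) powr p"
              unfolding f_def using p a h by (intro powr_mono2 norm_damped_orbit_le) auto
            also have "\<dots> = (exp (- h) ^ i) powr p * (M\<^sub>\<omega> * norm x) powr p"
              by (rule powr_mult)
            also have "\<dots> \<le> exp (- h) ^ i * (M\<^sub>\<omega> * norm x) powr p"
              using p h by (intro mult_right_mono powr_le_one_le power_le_one) auto
            finally show "norm (f i) powr p \<le> exp (- h) ^ i * (M\<^sub>\<omega> * norm x) powr p" .
          qed
          also have "\<dots> = (M\<^sub>\<omega> * norm x) powr p * (\<Sum>i<Suc K. exp (- h) ^ i)"
            by (simp add: sum_distrib_left mult.commute del: sum.lessThan_Suc)
          also have "\<dots> \<le> (M\<^sub>\<omega> * norm x) powr p * ((1 + h) / h)"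
          proof (intro mult_left_mono)
            have eh: "exp (- h) < 1"
              using h by simp
            have "(\<Sum>i<Suc K. exp (- h) ^ i) = (1 - exp (- h) ^ Suc K) / (1 - exp (- h))"
              using eh sum_gp_strict[of "exp (- h)" "Suc K"] by simp
            also have "\<dots> \<le> 1 / (1 - exp (- h))"
              using eh by (intro divide_right_mono) auto
            also have "\<dots> \<le> (1 + h) / h"
            proof -
              have "exp (- h) \<le> 1 / (1 + h)"
                using exp_ge_add_one_self[of h] h by (simp add: exp_minus field_simps)
              then have "h / (1 + h) \<le> 1 - exp (- h)"
                using h by (simp add: field_simps)
              then show ?thesis
                using eh h by (simp add: field_simps)
            qed
            finally show "(\<Sum>i<Suc K. exp (- h) ^ i) \<le> (1 + h) / h" .
          qed simp
          finally show "(\<Sum>i<Suc K. norm (f i) powr p) \<le> (M\<^sub>\<omega> * norm x) powr p * ((1 + h) / h)" .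
        qed simp
        finally have upper: "(\<Sum>k<Suc K. norm (u k) powr p)
            \<le> (g t * (M\<^sub>\<omega> * norm x)) powr p * ((1 + h) / h)"
          using gt M\<omega> by (simp add: powr_mult del: sum.lessThan_Suc)
        have lower: "norm (S a t (V a h x)) powr p \<le> (2 * \<omega> * h * M) powr p * norm (u k) powr p"
          if k: "k \<in> {Suc K - l..<Suc K}" for k
        proof -
          have kK: "real k \<le> real K" "real K + 1 \<le> real k + real l"
            using k lK by auto
          then have "real k \<le> t * real l" "t * real l \<le> real k + real l"
            using K by linarith+
          then have kh: "real k * h \<le> t" "t - real k * h \<le> 1" "real (Suc k) * h \<ge> t - 1"
            using l by (auto simp: h_def field_simps)
          \<comment> \<open>As \<open>(k + 1) h \<ge> t - 1 \<ge> 1\<close>, the weight is at least \<open>1 / (2 \<omega> h)\<close>; here \<open>1 - exp (- 1) \<ge> 1/2\<close> suffices.\<close>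
          have "1 \<le> \<omega> * (real (Suc k) * h)"
            using mult_mono[OF \<omega>, of 1 "real (Suc k) * h"] kh(3) False \<omega>0 by simp
          then have "exp (- (\<omega> * (real (Suc k) * h))) \<le> exp (- 1)"
            by simp
          also have "exp (- 1 :: real) \<le> 1 / 2"
            using exp_ge_add_one_self[of "1 :: real"] by (simp add: exp_minus field_simps)
          finally have "1 / (2 * \<omega>) \<le> (1 - exp (- (\<omega> * (real (Suc k) * h)))) / \<omega>"
            using \<omega>0 by (simp add: field_simps)
          also have "\<dots> \<le> h * weight h k"
            by (rule weight_ge[OF h(1)])
          finally have wk: "1 \<le> 2 * \<omega> * h * weight h k"
            using \<omega>0 by (simp add: field_simps)
          have "norm (S a t (V a h x)) = norm (S a (t - real k * h) (S a (real k * h) (V a h x)))"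
            using kh h by (subst S_add) auto
          also have "\<dots> \<le> 1 * (M * norm (S a (real k * h) (V a h x)))"
            using SM kh by simp
          also have "\<dots> \<le> 2 * \<omega> * h * weight h k * (M * norm (S a (real k * h) (V a h x)))"
            using wk M0 by (intro mult_right_mono) auto
          also have "\<dots> = 2 * \<omega> * h * M * norm (u k)"
            using w by (simp add: u_def)
          finally have "norm (S a t (V a h x)) powr p \<le> (2 * \<omega> * h * M * norm (u k)) powr p"
            using p by (intro powr_mono2) auto
          then show ?thesis
            using \<omega>0 h M0 by (simp add: powr_mult)
        qed
        have "real l * norm (S a t (V a h x)) powr p
            = (\<Sum>k\<in>{Suc K - l..<Suc K}. norm (S a t (V a h x)) powr p)"
          using lK by simp
        also have "\<dots> \<le> (\<Sum>k\<in>{Suc K - l..<Suc K}. (2 * \<omega> * h * M) powr p * norm (u k) powr p)"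
          by (intro sum_mono lower)
        also have "\<dots> \<le> (\<Sum>k<Suc K. (2 * \<omega> * h * M) powr p * norm (u k) powr p)"
          by (intro sum_mono2) auto
        also have "\<dots> \<le> (2 * \<omega> * h * M) powr p * ((g t * (M\<^sub>\<omega> * norm x)) powr p * ((1 + h) / h))"
          unfolding sum_distrib_left[symmetric] by (intro mult_left_mono upper) auto
        finally have "h * (real l * norm (S a t (V a h x)) powr p)
            \<le> h * ((2 * \<omega> * h * M) powr p * ((g t * (M\<^sub>\<omega> * norm x)) powr p * ((1 + h) / h)))"
          using h by (intro mult_left_mono) auto
        moreover have "h * (real l * norm (S a t (V a h x)) powr p) = norm (S a t (V a h x)) powr p"
          using h(3) by (simp add: mult.commute mult.left_commute)
        moreover have "h * ((2 * \<omega> * h * M) powr p * ((g t * (M\<^sub>\<omega> * norm x)) powr p * ((1 + h) / h)))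
            = h powr p * (?B powr p * (1 + h))"
          using h \<omega>0 M0 gt M\<omega> by (simp add: powr_mult)
        ultimately have "norm (S a t (V a h x)) powr p \<le> h powr p * (?B powr p * (1 + h))"
          by simp
        moreover have "norm (S a t ((1 / h) *\<^sub>R V a h x)) powr p = norm (S a t (V a h x)) powr p / h powr p"
          using t h by (simp add: linear_scale[OF S_linear] powr_divide)
        ultimately have "norm (S a t ((1 / h) *\<^sub>R V a h x)) powr p \<le> ?B powr p * (1 + h)"
          using h by (simp add: divide_le_eq mult.commute)
        then show ?thesis
          by (simp add: h_def l_def)
      qed
      have "(\<lambda>m. norm (S a t ((real (Suc m) / 1) *\<^sub>R V a (1 / real (Suc m)) x)) powr p)
          \<longlonglongrightarrow> norm (S a t x) powr p"
        using p t by (intro tendsto_powr' tendsto_norm tendsto_const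
            bounded_linear.tendsto[OF S_bounded_linear] V_quotient_LIMSEQ a) auto
      moreover have "(\<lambda>m. ?B powr p * (1 + 1 / real (Suc m))) \<longlonglongrightarrow> ?B powr p * (1 + 0)"
        by (intro tendsto_intros LIMSEQ_Suc[OF lim_1_over_n])
      ultimately have "norm (S a t x) powr p \<le> ?B powr p * (1 + 0)"
        by (rule LIMSEQ_le) (use discrete in auto)
      then show ?thesis
        using powr_less_mono2[of p ?B "norm (S a t x)"] p B0 by (cases "norm (S a t x) \<le> ?B") auto
    qed
    then have "onorm (T t) \<le> exp 1 * (2 * \<omega> * M * (g t * M\<^sub>\<omega>))"
      using t M\<omega> \<omega>0 M0 gt by (intro onorm_le_on_positive) (auto simp: a_def mult_ac)
    also have "\<dots> \<le> exp 1 * (M\<^sub>\<omega> * ((1 + 2 * M * \<omega>) * (g t + 1)))"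
      using M\<omega> M0 \<omega>0 gt by (intro mult_left_mono) (auto simp: algebra_simps)
    finally show ?thesis
      by (simp add: mult_ac)
  qed
qed

end


section \<open>Duality for finite sequences\<close>

text \<open>The nonnegative weights of norm at most \<open>1\<close> for the exponent conjugate to \<open>p\<close>, described by their
  pairings so that the case \<open>p = 1\<close> is included.\<close>

definition dual_ball :: "real \<Rightarrow> nat \<Rightarrow> (nat \<Rightarrow> real) set"
  where "dual_ball p n = {b. (\<forall>i. 0 \<le> b i) \<and>
    (\<forall>v. (\<forall>i. 0 \<le> v i) \<longrightarrow> (\<Sum>i<n. b i * v i) powr p \<le> (\<Sum>i<n. v i powr p))}"

text \<open>Young's inequality for the conjugate exponents \<open>p / (p - 1)\<close> and \<open>p\<close>, in a form that includes
  \<open>p = 1\<close>.\<close>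

lemma powr_mult_le_convex_combination:
  fixes x y p :: real
  assumes p: "p \<ge> 1" and "x \<ge> 0" "y \<ge> 0"
  shows "x powr (p - 1) * y \<le> (1 - 1 / p) * x powr p + 1 / p * y powr p"
proof (cases "x = 0 \<or> y = 0")
  case True
  then show ?thesis
    using p by auto
next
  case False
  then have "(x powr p) powr (1 - 1 / p) * (y powr p) powr (1 / p)
      \<le> (1 - 1 / p) * x powr p + 1 / p * y powr p"
    using p assms by (intro Youngs_inequality_0) auto
  moreover have "p * (1 - 1 / p) = p - 1"
    using p by (simp add: algebra_simps)
  ultimately show ?thesis
    using p assms by (simp add: powr_powr)
qed

text \<open>The pairing of the shifted weights with \<open>v\<close> is the pairing of \<open>b\<close> with \<open>v\<close> shifted the other way.\<close>

lemma shifted_sum_le_dual: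
  assumes b: "b \<in> dual_ball p n" and v: "\<And>i. 0 \<le> v i" and p: "p \<ge> 1" and j: "j < n"
  shows "(\<Sum>i<n - j. b (i + j) * v i) \<le> (\<Sum>i<n. v i powr p) powr (1 / p)"
proof -
  define v' where "v' k = (if j \<le> k then v (k - j) else 0)" for k
  have split: "(\<Sum>k<n. F k) = (\<Sum>i<n - j. F (i + j))" if "\<And>k. k < j \<Longrightarrow> F k = 0" for F :: "nat \<Rightarrow> real"
  proof -
    have "(\<Sum>k<n. F k) = (\<Sum>k\<in>{j..<n}. F k)"
      using that by (intro sum.mono_neutral_right) auto
    also have "\<dots> = (\<Sum>i<n - j. F (i + j))"
      using j sum.shift_bounds_nat_ivl[of F 0 j "n - j"] by (simp add: atLeast0LessThan)
    finally show ?thesis .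
  qed
  have sum: "(\<Sum>k<n. b k * v' k) = (\<Sum>i<n - j. b (i + j) * v i)"
    by (subst split) (auto simp: v'_def)
  have "(\<Sum>k<n. b k * v' k) powr p \<le> (\<Sum>k<n. v' k powr p)"
    using b v by (auto simp: dual_ball_def v'_def)
  also have "\<dots> = (\<Sum>i<n - j. v i powr p)"
    by (subst split) (auto simp: v'_def)
  also have "\<dots> \<le> (\<Sum>i<n. v i powr p)"
    by (intro sum_mono2) auto
  finally have "((\<Sum>k<n. b k * v' k) powr p) powr (1 / p) \<le> (\<Sum>i<n. v i powr p) powr (1 / p)"
    using p by (intro powr_mono2) auto
  moreover have "0 \<le> (\<Sum>k<n. b k * v' k)"
    using b v by (intro sum_nonneg) (auto simp: dual_ball_def v'_def)
  ultimately show ?thesis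
    using p by (simp add: powr_powr sum)
qed

text \<open>An inequality between classes holds almost everywhere for each choice of weights. Only countably
  many weights may be combined into one exceptional null set, so the dual ball is tested on
  rational weights.\<close>

definition rat_sequences :: "(nat \<Rightarrow> real) set"
  where "rat_sequences = range (\<lambda>l i. if i < length l then real_of_rat (l ! i) else 0)"

lemma countable_rat_sequences: "countable rat_sequences"
  by (simp add: rat_sequences_def)

text \<open>The weights \<open>b i = (v i / N)\<^sup>p\<^sup>-\<^sup>1\<close>, where \<open>N\<close> is the \<open>\<ell>\<^sup>p\<close> norm of \<open>v\<close>, lie in the dual ball by
  Young's inequality, and their pairing with \<open>v\<close> is \<open>N\<close>. Rational weights approximate them from
  below.\<close>

lemma sum_powr_le_if_dual_le:
  assumes p: "p \<ge> 1" and v: "\<And>i. 0 \<le> v i" and \<gamma>: "\<gamma> \<ge> 0"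
    and bound: "\<And>b. b \<in> dual_ball p n \<inter> rat_sequences \<Longrightarrow> (\<Sum>i<n. b i * v i) \<le> \<gamma>"
  shows "(\<Sum>i<n. v i powr p) \<le> \<gamma> powr p"
proof (cases "(\<Sum>i<n. v i powr p) = 0")
  case True
  then show ?thesis
    by simp
next
  case False
  define s where "s = (\<Sum>i<n. v i powr p)"
  have s: "s > 0"
    using False sum_nonneg[of "{..<n}" "\<lambda>i. v i powr p"] by (simp add: s_def less_le)
  define N where "N = s powr (1 / p)"
  have N: "N > 0" "N powr p = s"
    using s p by (auto simp: N_def powr_powr)
  define b where "b i = (if i < n then (v i / N) powr (p - 1) else 0)" for i
  have b0: "0 \<le> b i" for i
    by (simp add: b_def)
  have b_dual: "(\<Sum>i<n. b i * w i) powr p \<le> (\<Sum>i<n. w i powr p)" if w: "\<And>i. 0 \<le> w i" for w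
  proof (cases "(\<Sum>i<n. w i powr p) = 0")
    case True
    then have "\<forall>i<n. w i = 0"
      by (subst (asm) sum_nonneg_eq_0_iff) auto
    then show ?thesis
      using p True by simp
  next
    case False
    define W where "W = (\<Sum>i<n. w i powr p) powr (1 / p)"
    have pos: "(\<Sum>i<n. w i powr p) > 0"
      using False sum_nonneg[of "{..<n}" "\<lambda>i. w i powr p"] by (simp add: less_le)
    then have W: "W > 0" "W powr p = (\<Sum>i<n. w i powr p)"
      using p by (auto simp: W_def powr_powr)
    have "(\<Sum>i<n. b i * w i) / W = (\<Sum>i<n. (v i / N) powr (p - 1) * (w i / W))"
      by (simp add: sum_divide_distrib b_def)
    also have "\<dots> \<le> (\<Sum>i<n. (1 - 1 / p) * (v i / N) powr p + 1 / p * (w i / W) powr p)"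
      using v w N W p by (intro sum_mono powr_mult_le_convex_combination) auto
    also have "\<dots> = (1 - 1 / p) * ((\<Sum>i<n. v i powr p) / N powr p)
        + 1 / p * ((\<Sum>i<n. w i powr p) / W powr p)"
      by (simp add: sum.distrib sum_distrib_left[symmetric] powr_divide sum_divide_distrib[symmetric]
          del: times_divide_eq_left times_divide_eq_right)
    also have "\<dots> = 1"
      using s pos by (simp add: N W s_def[symmetric])
    finally have "(\<Sum>i<n. b i * w i) \<le> W"
      using W by (simp add: divide_le_eq)
    then have "(\<Sum>i<n. b i * w i) powr p \<le> W powr p"
      using p w b0 by (intro powr_mono2 sum_nonneg) auto
    then show ?thesis
      by (simp add: W)
  qed
  have bv: "(\<Sum>i<n. b i * v i) = N"
  proof -
    have "b i * v i = v i powr p / N powr (p - 1)" if "i < n" for i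
    proof (cases "v i = 0")
      case False
      then have "v i powr (p - 1) * v i = v i powr p"
        using v[of i] powr_add[of "v i" "p - 1" 1] by simp
      then show ?thesis
        using that by (simp add: b_def powr_divide)
    qed (use p in simp)
    then have "(\<Sum>i<n. b i * v i) = N powr p / N powr (p - 1)"
      by (simp add: sum_divide_distrib[symmetric] s_def[symmetric] N)
    also have "\<dots> = N powr (p - (p - 1))"
      by (rule powr_diff[symmetric])
    finally show ?thesis
      using N by simp
  qed
  have "N \<le> \<gamma> + (\<Sum>i<n. v i) * (1 / real (Suc m))" for m
  proof -
    \<comment> \<open>Rounding the weights down keeps them in the dual ball.\<close>
    define r :: "nat \<Rightarrow> rat" where "r i = of_int \<lfloor>b i * real (Suc m)\<rfloor> / of_nat (Suc m)" for i
    have r: "real_of_rat (r i) = of_int \<lfloor>b i * real (Suc m)\<rfloor> / real (Suc m)" for i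
      by (simp add: r_def of_rat_divide del: of_nat_Suc)
    have r0: "0 \<le> real_of_rat (r i)" for i
      unfolding r using b0[of i] by (intro divide_nonneg_nonneg) auto
    have rb: "real_of_rat (r i) \<le> b i" for i
      unfolding r by (simp add: divide_le_eq del: of_nat_Suc)
    have br: "b i \<le> real_of_rat (r i) + 1 / real (Suc m)" for i
    proof -
      have "b i * real (Suc m) \<le> of_int \<lfloor>b i * real (Suc m)\<rfloor> + 1"
        by linarith
      then have "b i \<le> (of_int \<lfloor>b i * real (Suc m)\<rfloor> + 1) / real (Suc m)"
        by (simp add: le_divide_eq del: of_nat_Suc)
      then show ?thesis
        by (simp add: r add_divide_distrib)
    qed
    define c where "c i = (if i < n then real_of_rat (r i) else 0)" for i
    have "c = (\<lambda>i. if i < length (map r [0..<n]) then real_of_rat (map r [0..<n] ! i) else 0)"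
      by (auto simp: c_def)
    then have "c \<in> rat_sequences"
      unfolding rat_sequences_def by blast
    moreover have "(\<Sum>i<n. c i * w i) powr p \<le> (\<Sum>i<n. w i powr p)" if w: "\<And>i. 0 \<le> w i" for w
    proof -
      have "(\<Sum>i<n. c i * w i) powr p \<le> (\<Sum>i<n. b i * w i) powr p"
        using p w r0 rb by (intro powr_mono2 sum_mono mult_right_mono sum_nonneg) (auto simp: c_def)
      then show ?thesis
        using b_dual[of w, OF w] by simp
    qed
    then have "c \<in> dual_ball p n"
      using r0 by (simp add: dual_ball_def c_def)
    ultimately have "(\<Sum>i<n. c i * v i) \<le> \<gamma>"
      by (intro bound) auto
    moreover have "N \<le> (\<Sum>i<n. (c i + 1 / real (Suc m)) * v i)"
      unfolding bv[symmetric] using br v by (intro sum_mono mult_right_mono) (auto simp: c_def)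
    ultimately show ?thesis
      by (simp add: ring_distribs sum.distrib sum_divide_distrib)
  qed
  moreover have "(\<lambda>m. \<gamma> + (\<Sum>i<n. v i) * (1 / real (Suc m))) \<longlonglongrightarrow> \<gamma> + (\<Sum>i<n. v i) * 0"
    by (intro tendsto_intros LIMSEQ_Suc[OF lim_1_over_n])
  ultimately have "N \<le> \<gamma> + (\<Sum>i<n. v i) * 0"
    by (intro LIMSEQ_le_const) auto
  then have "N powr p \<le> \<gamma> powr p"
    using N p by (intro powr_mono2) auto
  then show ?thesis
    by (simp add: N s_def)
qed


section \<open>Lebesgue spaces\<close>

lemma scaleC_minus_one: "(-1) *\<^sub>C x = - (x :: 'a::complex_banach)"
  using scaleC_of_real[of "-1" x] by simp

lemma
  assumes L: "Lp_space p \<Omega> \<Phi> R P" and f: "f \<in> Lp_functions p \<Omega>"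
  shows Lp_class_eq_iff: "h \<in> Lp_functions p \<Omega> \<Longrightarrow> \<Phi> f = \<Phi> h \<longleftrightarrow> (AE w in \<Omega>. f w = h w)"
    and Lp_class_add: "h \<in> Lp_functions p \<Omega> \<Longrightarrow> \<Phi> (\<lambda>w. f w + h w) = \<Phi> f + \<Phi> h"
    and Lp_class_scale: "\<Phi> (\<lambda>w. c * f w) = c *\<^sub>C \<Phi> f"
  using L f by (simp_all add: Lp_space_def)

lemma Lp_positive_representative:
  assumes L: "Lp_space p \<Omega> \<Phi> R P" and x: "x \<in> P"
  shows "\<exists>r. (\<forall>w. 0 \<le> r w) \<and> (\<lambda>w. complex_of_real (r w)) \<in> Lp_functions p \<Omega> \<and>
    x = \<Phi> (\<lambda>w. complex_of_real (r w))"
proof -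
  obtain f where f: "f \<in> Lp_functions p \<Omega>" "AE w in \<Omega>. f w \<in> \<real>\<^sub>\<ge>\<^sub>0" and xf: "x = \<Phi> f"
    using L x by (auto simp: Lp_space_def)
  have f_meas [measurable]: "f \<in> borel_measurable \<Omega>"
    using f(1) by (simp add: Lp_functions_def)
  have in_Lp: "(\<lambda>w. complex_of_real (cmod (f w))) \<in> Lp_functions p \<Omega>"
    using f(1) by (auto simp: Lp_functions_def split: if_splits)
  have "AE w in \<Omega>. f w = complex_of_real (cmod (f w))"
    using f(2) by eventually_elim (auto simp: complex_nonneg_Reals_iff complex_eq_iff cmod_def)
  then have "x = \<Phi> (\<lambda>w. complex_of_real (cmod (f w)))"
    using L f(1) in_Lp xf by (auto simp: Lp_space_def)
  with in_Lp show ?thesis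
    by (intro exI[of _ "\<lambda>w. cmod (f w)"]) simp
qed

lemma Lp_positive_iff:
  assumes L: "Lp_space p \<Omega> \<Phi> R P" and r: "(\<lambda>w. complex_of_real (r w)) \<in> Lp_functions p \<Omega>"
  shows "\<Phi> (\<lambda>w. complex_of_real (r w)) \<in> P \<longleftrightarrow> (AE w in \<Omega>. 0 \<le> r w)"
proof
  assume "\<Phi> (\<lambda>w. complex_of_real (r w)) \<in> P"
  then obtain s where s: "\<And>w. 0 \<le> s w"
      "(\<lambda>w. complex_of_real (s w)) \<in> Lp_functions p \<Omega>"
      "\<Phi> (\<lambda>w. complex_of_real (r w)) = \<Phi> (\<lambda>w. complex_of_real (s w))"
    using Lp_positive_representative[OF L] by blast
  then have "AE w in \<Omega>. complex_of_real (r w) = complex_of_real (s w)"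
    using Lp_class_eq_iff[OF L r] by simp
  then show "AE w in \<Omega>. 0 \<le> r w"
    by eventually_elim (use s(1) in simp)
next
  assume "AE w in \<Omega>. 0 \<le> r w"
  then show "\<Phi> (\<lambda>w. complex_of_real (r w)) \<in> P"
    using L r by (auto simp: Lp_space_def)
qed

text \<open>The common upper bound is the constant function \<open>B\<close>.\<close>

lemma Linf_dominated:
  fixes \<Phi> :: "('w \<Rightarrow> complex) \<Rightarrow> 'a::complex_banach" and f :: "nat \<Rightarrow> 'a"
  assumes L: "Lp_space \<infinity> \<Omega> \<Phi> R P" and B: "B \<ge> 0"
    and f: "\<And>i. i < n \<Longrightarrow> f i \<in> P \<and> norm (f i) \<le> B"
  shows "\<exists>F\<in>P. norm F \<le> B \<and> (\<forall>i<n. F - f i \<in> P)"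
proof -
  have bounded_in: "(\<lambda>w. complex_of_real (r w)) \<in> Lp_functions \<infinity> \<Omega>"
    and bounded_norm: "norm (\<Phi> (\<lambda>w. complex_of_real (r w))) \<le> B"
    if [measurable]: "r \<in> borel_measurable \<Omega>" and AE: "AE w in \<Omega>. \<bar>r w\<bar> \<le> B" for r
  proof -
    have e: "esssup \<Omega> (\<lambda>w. ereal (cmod (complex_of_real (r w)))) \<le> ereal B"
      using AE by (intro esssup_I) auto
    also have "\<dots> < \<infinity>"
      by simp
    finally show in_L: "(\<lambda>w. complex_of_real (r w)) \<in> Lp_functions \<infinity> \<Omega>"
      by (simp add: Lp_functions_def)
    have "real_of_ereal (esssup \<Omega> (\<lambda>w. ereal (cmod (complex_of_real (r w))))) \<le> B"
      using e B by (cases "esssup \<Omega> (\<lambda>w. ereal (cmod (complex_of_real (r w))))") auto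
    then show "norm (\<Phi> (\<lambda>w. complex_of_real (r w))) \<le> B"
      using L in_L by (simp add: Lp_space_def Lp_norm_def)
  qed
  define F where "F = \<Phi> (\<lambda>w. complex_of_real B)"
  have const: "(\<lambda>w. complex_of_real B) \<in> Lp_functions \<infinity> \<Omega>"
    by (rule bounded_in) (use B in auto)
  have "F - f i \<in> P" if i: "i < n" for i
  proof -
    have "f i \<in> P"
      using f[OF i] by simp
    then obtain r where r: "\<And>w. 0 \<le> r w"
        and rL: "(\<lambda>w. complex_of_real (r w)) \<in> Lp_functions \<infinity> \<Omega>"
        and fr: "f i = \<Phi> (\<lambda>w. complex_of_real (r w))"
      using Lp_positive_representative[OF L] by blast
    have r_meas [measurable]: "r \<in> borel_measurable \<Omega>"
      using rL by (simp add: Lp_functions_def borel_measurable_complex_iff)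
    define e where "e = esssup \<Omega> (\<lambda>w. ereal (cmod (complex_of_real (r w))))"
    have e: "e < \<infinity>" "real_of_ereal e \<le> B"
      using rL L f[OF i] by (simp_all add: e_def fr Lp_functions_def Lp_space_def Lp_norm_def)
    have "AE w in \<Omega>. ereal (cmod (complex_of_real (r w))) \<le> e"
      unfolding e_def by (rule esssup_AE)
    then have rB: "AE w in \<Omega>. r w \<le> B"
      by eventually_elim (use e r in \<open>cases e; auto\<close>)
    have mr: "(\<lambda>w. -1 * complex_of_real (r w)) \<in> Lp_functions \<infinity> \<Omega>"
      using rL by (simp add: Lp_functions_def)
    have "F - f i = F + (-1) *\<^sub>C f i"
      by (simp add: scaleC_minus_one)
    also have "\<dots> = \<Phi> (\<lambda>w. complex_of_real B + -1 * complex_of_real (r w))"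
      unfolding F_def fr Lp_class_add[OF L const mr] Lp_class_scale[OF L rL] ..
    also have "\<dots> = \<Phi> (\<lambda>w. complex_of_real (B - r w))"
      by simp
    also have "\<dots> \<in> P"
    proof (subst Lp_positive_iff[OF L])
      have "AE w in \<Omega>. \<bar>B - r w\<bar> \<le> B"
        using rB by eventually_elim (use r in auto)
      then show "(\<lambda>w. complex_of_real (B - r w)) \<in> Lp_functions \<infinity> \<Omega>"
        by (intro bounded_in) auto
      show "AE w in \<Omega>. 0 \<le> B - r w"
        using rB by eventually_elim simp
    qed
    finally show ?thesis .
  qed
  moreover have "F \<in> P"
    unfolding F_def using B const by (subst Lp_positive_iff[OF L]) auto
  moreover have "norm F \<le> B"
    unfolding F_def by (rule bounded_norm) (use B in auto)
  ultimately show ?thesis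
    by blast
qed

text \<open>Every element of the cone has a nonnegative representative, so for finite exponents the
  argument only meets classes of real functions.\<close>

locale finite_Lp =
  fixes q :: real and \<Omega> :: "'w measure" and \<Phi> :: "('w \<Rightarrow> complex) \<Rightarrow> 'a::complex_banach"
    and R P :: "'a set"
  assumes q: "q \<ge> 1" and Lp: "Lp_space (ennreal q) \<Omega> \<Phi> R P"
begin

definition integrable_fun :: "('w \<Rightarrow> real) \<Rightarrow> bool"
  where "integrable_fun r \<longleftrightarrow> r \<in> borel_measurable \<Omega> \<and> integrable \<Omega> (\<lambda>w. \<bar>r w\<bar> powr q)"

definition real_class :: "('w \<Rightarrow> real) \<Rightarrow> 'a"
  where "real_class r = \<Phi> (\<lambda>w. complex_of_real (r w))"

lemma in_Lp_functions_iff: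
  "(\<lambda>w. complex_of_real (r w)) \<in> Lp_functions (ennreal q) \<Omega> \<longleftrightarrow> integrable_fun r"
  using q by (simp add: Lp_functions_def integrable_fun_def borel_measurable_complex_iff)

lemma norm_real_class:
  assumes "integrable_fun r"
  shows "norm (real_class r) powr q = (\<integral>w. \<bar>r w\<bar> powr q \<partial>\<Omega>)"
proof -
  have "norm (real_class r) = (\<integral>w. \<bar>r w\<bar> powr q \<partial>\<Omega>) powr (1 / q)"
    using Lp assms q unfolding Lp_space_def real_class_def
    by (simp add: in_Lp_functions_iff Lp_norm_def)
  then show ?thesis
    using q by (simp add: powr_powr)
qed

lemma real_class_positive_iff:
  "integrable_fun r \<Longrightarrow> real_class r \<in> P \<longleftrightarrow> (AE w in \<Omega>. 0 \<le> r w)"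
  unfolding real_class_def by (rule Lp_positive_iff[OF Lp]) (simp add: in_Lp_functions_iff)

lemma positive_eq_real_class:
  assumes "x \<in> P"
  shows "\<exists>r. (\<forall>w. 0 \<le> r w) \<and> integrable_fun r \<and> x = real_class r"
  using Lp_positive_representative[OF Lp assms] by (simp add: real_class_def in_Lp_functions_iff)

lemma integrable_fun_scale: "integrable_fun r \<Longrightarrow> integrable_fun (\<lambda>w. c * r w)"
  by (auto simp: integrable_fun_def abs_mult powr_mult)

lemma integrable_fun_add:
  assumes r: "integrable_fun r" and s: "integrable_fun s"
  shows "integrable_fun (\<lambda>w. r w + s w)"
proof -
  have meas [measurable]: "r \<in> borel_measurable \<Omega>" "s \<in> borel_measurable \<Omega>"
    using assms by (auto simp: integrable_fun_def)
  have "integrable \<Omega> (\<lambda>w. 2 powr q * (\<bar>r w\<bar> powr q + \<bar>s w\<bar> powr q))"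
    using assms by (auto simp: integrable_fun_def)
  then have "integrable \<Omega> (\<lambda>w. \<bar>r w + s w\<bar> powr q)"
  proof (rule Bochner_Integration.integrable_bound)
    show "AE w in \<Omega>. norm (\<bar>r w + s w\<bar> powr q) \<le> norm (2 powr q * (\<bar>r w\<bar> powr q + \<bar>s w\<bar> powr q))"
    proof (rule AE_I2)
      fix w
      have "\<bar>r w + s w\<bar> powr q \<le> (2 * max \<bar>r w\<bar> \<bar>s w\<bar>) powr q"
        using q by (intro powr_mono2) auto
      also have "\<dots> = 2 powr q * max \<bar>r w\<bar> \<bar>s w\<bar> powr q"
        by (rule powr_mult)
      also have "\<dots> \<le> 2 powr q * (\<bar>r w\<bar> powr q + \<bar>s w\<bar> powr q)"
        by (intro mult_left_mono) (auto simp: max_def)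
      finally show "norm (\<bar>r w + s w\<bar> powr q) \<le> norm (2 powr q * (\<bar>r w\<bar> powr q + \<bar>s w\<bar> powr q))"
        by simp
    qed
  qed simp
  then show ?thesis
    by (simp add: integrable_fun_def)
qed

lemma real_class_add:
  "integrable_fun r \<Longrightarrow> integrable_fun s \<Longrightarrow> real_class (\<lambda>w. r w + s w) = real_class r + real_class s"
  using Lp unfolding Lp_space_def real_class_def by (simp add: in_Lp_functions_iff)

lemma real_class_scale:
  assumes "integrable_fun r"
  shows "real_class (\<lambda>w. c * r w) = c *\<^sub>R real_class r"
proof -
  have "real_class (\<lambda>w. c * r w) = complex_of_real c *\<^sub>C real_class r"
    using Lp assms unfolding Lp_space_def real_class_def by (simp add: in_Lp_functions_iff)
  then show ?thesis
    by (simp add: scaleC_of_real)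
qed

lemma real_class_linear_combination:
  assumes "integrable_fun s" and "\<And>i. i \<in> I \<Longrightarrow> integrable_fun (r i)" and "finite I"
  shows "integrable_fun (\<lambda>w. s w - (\<Sum>i\<in>I. c i * r i w)) \<and>
    real_class (\<lambda>w. s w - (\<Sum>i\<in>I. c i * r i w)) = real_class s - (\<Sum>i\<in>I. c i *\<^sub>R real_class (r i))"
  using \<open>finite I\<close> assms(2)
proof (induction I)
  case empty
  then show ?case
    using assms(1) by simp
next
  case (insert j I)
  have j: "integrable_fun (\<lambda>w. (- c j) * r j w)"
    by (rule integrable_fun_scale) (use insert in simp)
  have eq: "(\<lambda>w. s w - (\<Sum>i\<in>insert j I. c i * r i w))
      = (\<lambda>w. (s w - (\<Sum>i\<in>I. c i * r i w)) + (- c j) * r j w)"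
    using insert.hyps by (auto simp: algebra_simps)
  have IH: "integrable_fun (\<lambda>w. s w - (\<Sum>i\<in>I. c i * r i w))"
    "real_class (\<lambda>w. s w - (\<Sum>i\<in>I. c i * r i w)) = real_class s - (\<Sum>i\<in>I. c i *\<^sub>R real_class (r i))"
    using insert by auto
  show ?case
    unfolding eq real_class_add[OF IH(1) j] IH(2)
    using integrable_fun_add[OF IH(1) j] insert real_class_scale[of "r j" "- c j"] by simp
qed

text \<open>The vector \<open>F\<close> is the class of the function \<open>s\<close> whose value at each point is the \<open>\<ell>\<^sup>q\<close> norm of
  the values of representatives of the \<open>f i\<close>.\<close>

lemma Lp_dominated:
  assumes f: "\<And>i. i < n \<Longrightarrow> f i \<in> P"
  shows "\<exists>F\<in>P. norm F powr q = (\<Sum>i<n. norm (f i) powr q) \<and>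
    (\<forall>b\<in>dual_ball q n. \<forall>j<n. F - (\<Sum>i<n - j. b (i + j) *\<^sub>R f i) \<in> P)"
proof -
  have "\<exists>r. (\<forall>w. 0 \<le> r w) \<and> integrable_fun r \<and> (i < n \<longrightarrow> f i = real_class r)" for i
  proof (cases "i < n")
    case True
    then show ?thesis
      using positive_eq_real_class[OF f] by auto
  next
    case False
    then show ?thesis
      by (intro exI[of _ "\<lambda>_. 0"]) (simp add: integrable_fun_def)
  qed
  then obtain r where r0: "\<And>i w. 0 \<le> r i w" and r: "\<And>i. integrable_fun (r i)"
    and fr: "\<And>i. i < n \<Longrightarrow> f i = real_class (r i)"
    by metis
  have meas [measurable]: "r i \<in> borel_measurable \<Omega>" for i
    using r by (simp add: integrable_fun_def)
  define s where "s w = (\<Sum>i<n. r i w powr q) powr (1 / q)" for w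
  have s_powr: "s w powr q = (\<Sum>i<n. r i w powr q)" for w
    using q by (simp add: s_def powr_powr sum_nonneg)
  have int: "integrable \<Omega> (\<lambda>w. r i w powr q)" for i
    using r[of i] r0 by (simp add: integrable_fun_def)
  have s: "integrable_fun s"
    unfolding integrable_fun_def
  proof
    show "s \<in> borel_measurable \<Omega>"
      unfolding s_def[abs_def] by measurable
    have "\<bar>s w\<bar> powr q = (\<Sum>i<n. r i w powr q)" for w
      using s_powr[of w] by (simp add: s_def)
    then show "integrable \<Omega> (\<lambda>w. \<bar>s w\<bar> powr q)"
      using int by simp
  qed
  have s0: "0 \<le> s w" for w
    by (simp add: s_def)
  have "real_class s \<in> P"
    using s s0 by (simp add: real_class_positive_iff)
  moreover have "norm (real_class s) powr q = (\<Sum>i<n. norm (f i) powr q)"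
    using s r r0 s0 int by (simp add: fr norm_real_class s_powr)
  moreover have "real_class s - (\<Sum>i<n - j. b (i + j) *\<^sub>R f i) \<in> P"
    if "b \<in> dual_ball q n" "j < n" for b j
  proof -
    have comb: "integrable_fun (\<lambda>w. s w - (\<Sum>i<n - j. b (i + j) * r i w))"
      "real_class (\<lambda>w. s w - (\<Sum>i<n - j. b (i + j) * r i w))
        = real_class s - (\<Sum>i<n - j. b (i + j) *\<^sub>R real_class (r i))"
      using real_class_linear_combination[OF s, of "{..<n - j}" r "\<lambda>i. b (i + j)"] r by auto
    have "(\<Sum>i<n - j. b (i + j) * r i w) \<le> s w" for w
      unfolding s_def by (rule shifted_sum_le_dual[OF that(1) r0 q that(2)])
    then have "real_class (\<lambda>w. s w - (\<Sum>i<n - j. b (i + j) * r i w)) \<in> P"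
      using comb(1) by (simp add: real_class_positive_iff)
    then show ?thesis
      by (simp add: comb(2) fr)
  qed
  ultimately show ?thesis
    by blast
qed

text \<open>Outside one null set, \<open>s\<close> bounds the pairings of the values \<open>r k w\<close> with all rational weights, and
  hence their \<open>\<ell>\<^sup>q\<close> norm by duality. It remains to integrate.\<close>

lemma Lp_codominated:
  assumes u: "\<And>k. k < n \<Longrightarrow> u k \<in> P" and G: "G \<in> P"
    and dom: "\<And>b. b \<in> dual_ball q n \<Longrightarrow> G - (\<Sum>k<n. b k *\<^sub>R u k) \<in> P"
  shows "(\<Sum>k<n. norm (u k) powr q) \<le> norm G powr q"
proof -
  have "\<exists>r. (\<forall>w. 0 \<le> r w) \<and> integrable_fun r \<and> (k < n \<longrightarrow> u k = real_class r)" for k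
  proof (cases "k < n")
    case True
    then show ?thesis
      using positive_eq_real_class[OF u] by auto
  next
    case False
    then show ?thesis
      by (intro exI[of _ "\<lambda>_. 0"]) (simp add: integrable_fun_def)
  qed
  then obtain r where r0: "\<And>i w. 0 \<le> r i w" and r: "\<And>i. integrable_fun (r i)"
    and ur: "\<And>k. k < n \<Longrightarrow> u k = real_class (r k)"
    by metis
  obtain s where s0: "\<And>w. 0 \<le> s w" and s: "integrable_fun s" and Gs: "G = real_class s"
    using positive_eq_real_class[OF G] by auto
  have "AE w in \<Omega>. (\<Sum>k<n. b k * r k w) \<le> s w" if b: "b \<in> dual_ball q n" for b
  proof -
    have comb: "integrable_fun (\<lambda>w. s w - (\<Sum>k<n. b k * r k w))"
      "real_class (\<lambda>w. s w - (\<Sum>k<n. b k * r k w)) = real_class s - (\<Sum>k<n. b k *\<^sub>R real_class (r k))"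
      using real_class_linear_combination[OF s, of "{..<n}" r b] r by auto
    have "real_class (\<lambda>w. s w - (\<Sum>k<n. b k * r k w)) \<in> P"
      using dom[OF b] by (simp add: comb(2) Gs ur)
    then have "AE w in \<Omega>. 0 \<le> s w - (\<Sum>k<n. b k * r k w)"
      using comb(1) by (simp add: real_class_positive_iff)
    then show ?thesis
      by eventually_elim simp
  qed
  then have "AE w in \<Omega>. \<forall>b\<in>dual_ball q n \<inter> rat_sequences. (\<Sum>k<n. b k * r k w) \<le> s w"
    using countable_rat_sequences by (subst AE_ball_countable) auto
  then have AE: "AE w in \<Omega>. (\<Sum>k<n. r k w powr q) \<le> s w powr q"
  proof eventually_elim
    case (elim w)
    then show ?case
      using sum_powr_le_if_dual_le[of q "\<lambda>k. r k w" "s w" n] q r0 s0 by blast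
  qed
  have int: "integrable \<Omega> (\<lambda>w. r k w powr q)" "integrable \<Omega> (\<lambda>w. s w powr q)" for k
    using r[of k] r0 s s0 by (simp_all add: integrable_fun_def)
  have "(\<Sum>k<n. norm (u k) powr q) = (\<integral>w. (\<Sum>k<n. r k w powr q) \<partial>\<Omega>)"
    using r r0 int by (simp add: ur norm_real_class)
  also have "\<dots> \<le> (\<integral>w. s w powr q \<partial>\<Omega>)"
    using int AE by (intro integral_mono_AE) auto
  also have "\<dots> = norm G powr q"
    using s s0 by (simp add: Gs norm_real_class)
  finally show ?thesis .
qed

end


section \<open>Spaces of bounded continuous functions\<close>

text \<open>If the space contains the constant functions, the common upper bound is \<open>B\<close>; if it is a sublattice,
  it is the pointwise maximum of the functions and \<open>0\<close>.\<close>

lemma Cb_dominated: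
  fixes J :: "'a::complex_banach \<Rightarrow> ('v::topological_space \<Rightarrow>\<^sub>C complex)"
    and f :: "nat \<Rightarrow> 'a"
  assumes J: "Cb_subspace J R P" and "contains_one J \<or> pointwise_sublattice J R"
    and B: "B \<ge> 0" and f: "\<And>i. i < n \<Longrightarrow> f i \<in> P \<and> norm (f i) \<le> B"
  shows "\<exists>F\<in>P. norm F \<le> B \<and> (\<forall>i<n. F - f i \<in> P)"
proof -
  define ev where "ev x w = apply_bcontfun (J x) w" for x w
  have scale: "ev (c *\<^sub>C x) w = c * ev x w" for c x w
    using J by (simp add: Cb_subspace_def ev_def)
  have diff: "ev (x - y) w = ev x w - ev y w" for x y w
  proof -
    have "ev (x + (-1) *\<^sub>C y) w = ev x w + ev ((-1) *\<^sub>C y) w"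
      using J by (simp add: Cb_subspace_def ev_def)
    then show ?thesis
      using scale[of "-1" y w] by (simp add: scaleC_minus_one)
  qed
  have P: "x \<in> P \<longleftrightarrow> (\<forall>w. 0 \<le> Re (ev x w) \<and> Im (ev x w) = 0)" for x
    using J by (simp add: Cb_subspace_def ev_def complex_nonneg_Reals_iff)
  have R: "x \<in> R \<longleftrightarrow> (\<forall>w. Im (ev x w) = 0)" for x
    using J by (simp add: Cb_subspace_def ev_def complex_is_Real_iff)
  have norm_le: "norm x \<le> B" if "\<And>w. cmod (ev x w) \<le> B" for x
    using norm_bound[of "J x" B] that J by (simp add: Cb_subspace_def ev_def)
  have ev_le: "cmod (ev x w) \<le> norm x" for x w
    using norm_bounded[of "J x" w] J by (simp add: Cb_subspace_def ev_def)
  have f_ev: "0 \<le> Re (ev (f i) w)" "Re (ev (f i) w) \<le> B" "Im (ev (f i) w) = 0" if "i < n" for i w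
    using f[OF that] P ev_le[of "f i" w] complex_Re_le_cmod[of "ev (f i) w"] by fastforce+
  have real_cmod: "cmod z \<le> B" if "Im z = 0" "0 \<le> Re z" "Re z \<le> B" for z
    using that by (simp add: cmod_eq_Re)
  from assms(2) have "\<exists>F. (\<forall>w. Im (ev F w) = 0 \<and> 0 \<le> Re (ev F w) \<and> Re (ev F w) \<le> B) \<and>
      (\<forall>i<n. \<forall>w. Re (ev (f i) w) \<le> Re (ev F w))"
  proof
    assume "contains_one J"
    then obtain u where u: "\<And>w. ev u w = 1"
      by (auto simp: contains_one_def ev_def)
    show ?thesis
      by (rule exI[of _ "complex_of_real B *\<^sub>C u"]) (use B f_ev in \<open>simp add: scale u\<close>)
  next
    assume lat: "pointwise_sublattice J R"
    have "\<exists>F. (\<forall>w. Im (ev F w) = 0 \<and> 0 \<le> Re (ev F w) \<and> Re (ev F w) \<le> B) \<and>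
      (\<forall>i<m. \<forall>w. Re (ev (f i) w) \<le> Re (ev F w))" if "m \<le> n" for m
      using that
    proof (induction m)
      case 0
      show ?case
        by (rule exI[of _ 0]) (use diff[of 0 0] B in auto)
    next
      case (Suc m)
      then obtain F where F: "\<And>w. Im (ev F w) = 0 \<and> 0 \<le> Re (ev F w) \<and> Re (ev F w) \<le> B"
        "\<And>i w. i < m \<Longrightarrow> Re (ev (f i) w) \<le> Re (ev F w)"
        by auto
      have "F \<in> R" "f m \<in> R"
        using F f_ev(3)[of m] Suc.prems by (auto simp: R)
      then obtain H where H: "H \<in> R" "\<And>w. Re (ev H w) = max (Re (ev F w)) (Re (ev (f m) w))"
        using lat unfolding pointwise_sublattice_def ev_def by blast
      show ?case
      proof (rule exI[of _ H], intro conjI allI impI)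
        fix w
        show "Im (ev H w) = 0" "0 \<le> Re (ev H w)" "Re (ev H w) \<le> B"
          using H F(1)[of w] f_ev(2)[of m w] Suc.prems by (auto simp: R)
        fix i assume "i < Suc m"
        then show "Re (ev (f i) w) \<le> Re (ev H w)"
          using F(2)[of i w] by (auto simp: H(2) less_Suc_eq)
      qed
    qed
    then show ?thesis
      by blast
  qed
  then obtain F where F: "\<And>w. Im (ev F w) = 0 \<and> 0 \<le> Re (ev F w) \<and> Re (ev F w) \<le> B"
    and Ff: "\<And>i w. i < n \<Longrightarrow> Re (ev (f i) w) \<le> Re (ev F w)"
    by blast
  have "F \<in> P" "norm F \<le> B" "\<forall>i<n. F - f i \<in> P"
    using F Ff f_ev by (auto simp: P diff intro!: norm_le real_cmod)
  then show ?thesis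
    by blast
qed


section \<open>Growth of positive semigroups\<close>

theorem theorem3p8:
  fixes T :: "real \<Rightarrow> 'a::complex_banach \<Rightarrow> 'a"
    and D :: "'a set" and A :: "'a \<Rightarrow> 'a"
    and R P :: "'a set"
    and \<omega> M\<^sub>\<omega> M :: real
    and g :: "real \<Rightarrow> real"
    and p :: ennreal and \<Omega> :: "'w measure" and \<Phi> :: "('w \<Rightarrow> complex) \<Rightarrow> 'a"
    and J :: "'a \<Rightarrow> ('v::topological_space \<Rightarrow>\<^sub>C complex)"
  assumes nonzero: "\<exists>x::'a. x \<noteq> 0"
    and lattice: "complex_banach_lattice R P"
    and semigroup: "C0_semigroup T"
    and positive: "positive_semigroup P T"
    and generator: "generator T D (\<lambda>x. - A x)"
    and resolvent: "{l. Re l < 0} \<subseteq> resolvent_set D A"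
    and \<omega>: "\<omega> \<ge> 1" and M\<omega>: "M\<^sub>\<omega> \<ge> 1"
    and growth: "\<And>t. t \<ge> 0 \<Longrightarrow> onorm (T t) \<le> M\<^sub>\<omega> * exp (t * (\<omega> - 1))"
    and M: "M = (SUP t\<in>{0..2}. onorm (T t))"
    and g_pos: "\<And>s. s > 0 \<Longrightarrow> g s > 0"
    and g_mono: "mono_on {0<..} g"
    and g_bound: "\<And>a. a > 0 \<Longrightarrow>
      onorm (inv_into D (\<lambda>x. complex_of_real a *\<^sub>C x + A x)) \<le> g (1 / a)"
  shows "(Lp_space p \<Omega> \<Phi> R P \<longrightarrow>
           (\<forall>t>0. onorm (T t) \<le> exp 1 * M\<^sub>\<omega> * (1 + 2 * M * \<omega>) * (g t + 1))) \<and>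
         (Cb_subspace J R P \<and> (contains_one J \<or> pointwise_sublattice J R) \<longrightarrow>
           (\<forall>t>0. onorm (T t) \<le> exp 1 * M\<^sub>\<omega> * (1 + \<omega>) * (g t + 1)))"
proof (intro conjI impI allI; (elim conjE)?)
  interpret positive_C0_semigroup R P T D A \<omega> M\<^sub>\<omega> g
    by (intro positive_C0_semigroup.intro positive_C0_semigroup_axioms.intro) (fact assms)+
  fix t :: real assume t: "t > 0"
  {
    assume "Cb_subspace J R P" "contains_one J \<or> pointwise_sublattice J R"
    then show "onorm (T t) \<le> exp 1 * M\<^sub>\<omega> * (1 + \<omega>) * (g t + 1)"
      by (intro growth_if_dominated t) (rule Cb_dominated)
  }
  assume L: "Lp_space p \<Omega> \<Phi> R P"
  have "bdd_above ((\<lambda>t. onorm (T t)) ` {0..2})"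
  proof (rule bdd_aboveI2)
    fix r :: real assume r: "r \<in> {0..2}"
    then have "onorm (T r) \<le> M\<^sub>\<omega> * exp (r * (\<omega> - 1))"
      by (intro growth) auto
    also have "\<dots> \<le> M\<^sub>\<omega> * exp (2 * (\<omega> - 1))"
      using r \<omega> M\<omega> by (intro mult_left_mono) (use mult_right_mono[of r 2 "\<omega> - 1"] in auto)
    finally show "onorm (T r) \<le> M\<^sub>\<omega> * exp (2 * (\<omega> - 1))" .
  qed
  then have M_upper: "onorm (T r) \<le> M" if "0 \<le> r" "r \<le> 2" for r
    unfolding M using that by (intro cSUP_upper) auto
  show "onorm (T t) \<le> exp 1 * M\<^sub>\<omega> * (1 + 2 * M * \<omega>) * (g t + 1)"
  proof (cases p)
    case (real q)
    then have "q \<ge> 1"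
      using L by (simp add: Lp_space_def)
    then interpret finite_Lp q \<Omega> \<Phi> R P
      using L real by unfold_locales auto
    show ?thesis
      by (rule growth_if_p_dominated[where p = q and \<B> = "dual_ball q"])
        (use q t M_upper Lp_dominated Lp_codominated in auto)
  next
    case top
    \<comment> \<open>Since \<open>T 0\<close> is the identity, \<open>M \<ge> 1\<close>, and the constant for dominated spaces is the smaller one.\<close>
    obtain x :: 'a where x: "x \<noteq> 0"
      using nonzero by blast
    have "T 0 x = x"
      using semigroup by (simp add: C0_semigroup_def)
    then have "1 * norm x \<le> M * norm x"
      using onorm[OF T_bounded_linear[of 0], of x] mult_right_mono[OF M_upper[of 0], of "norm x"] by simp
    then have M1: "M \<ge> 1"
      using x mult_right_le_imp_le[of 1 "norm x" M] by simp
    have "onorm (T t) \<le> exp 1 * M\<^sub>\<omega> * (1 + \<omega>) * (g t + 1)"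
      using L top by (intro growth_if_dominated t) (rule Linf_dominated; simp)
    also have "\<dots> \<le> exp 1 * M\<^sub>\<omega> * (1 + 2 * M * \<omega>) * (g t + 1)"
      using M1 \<omega> M\<omega> g_pos[OF t] mult_right_mono[of 1 "2 * M" \<omega>]
      by (intro mult_right_mono mult_left_mono) auto
    finally show ?thesis .
  qed
qed

end
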